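(* Let $d,T\in\mathbb{N}$, $L>0$, and let $\eta_1,\dots,\eta_T>0$, $\sigma_1,\dots,\sigma_T>0$. Consider a noisy iterative algorithm in $\mathbb{R}^d$ with update rule $W_t=g(W_{t-1})-\eta_tF(W_{t-1},Z_t)+\xi_t$, $1\le t\le T$, as described in the context, with final output $W$ (a function of $W^T=(W_1,\dots,W_T)$). Suppose that $P(Z_{t+1}\mid Z^t,W^t,S)=P(Z_{t+1}\mid Z^t,S)$ for all $t$, that $\sup_{w,z}\|F(w,z)\|_1\le L$, and that $\xi_t\sim\mathcal{N}(0,\sigma_t^2I_d)$ for every $t$. Then $$\mathcal{L}(S\to W)\le\sum_{t=1}^T\log\left(\frac{V_1(d,\eta_tL)}{(2\pi\sigma_t^2)^{d/2}}+\frac{(2\eta_tL)^{d-1}\,\sigma_t\sqrt{2d}}{(2\pi\sigma_t^2)^{d/2}\,(d-1)!}\sum_{i=0}^{d-1}\binom{d-1}{i}\left(\frac{\sigma_t\sqrt{2d}}{\eta_tL}\right)^i\Gamma\left(\frac{i+1}{2}\right)\right),$$ where $V_1(d,r)=\dfrac{(2r)^d}{d!}$ is the volume of the $L_1$-ball of radius $r$ in $\mathbb{R}^d$.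
   Context: Maximal leakage: for random variables $X,Y$ with joint law $P_{XY}$, $\mathcal{L}(X\to Y)=I_\infty(X,Y)=\min_{Q_Y}D_\infty(P_{XY}\|P_XQ_Y)=\log\mathbb{E}_{P_Y}\big[\operatorname{ess\,sup}_{P_X}\frac{dP_{XY}}{d(P_XP_Y)}\big]$, where $D_\infty$ is the Rényi divergence of order $\infty$. If $X,Y$ are jointly continuous this equals $\log\int\operatorname{ess\,sup}_{P_X}f_{Y|X}(y|x)\,dy$. Logarithms are natural. Setup: $S=(Z'_1,\dots,Z'_n)$ is a data set of $n$ i.i.d. samples from an unknown distribution on a sample space $\mathcal{Z}$. The algorithm generates $W_t=g(W_{t-1})-\eta_tF(W_{t-1},Z_t)+\xi_t$ for $t=1,\dots,T$, where $Z_t\subseteq S$ is a (possibly random) subset (mini-batch) of the data sampled according to some distribution, $g:\mathbb{R}^d\to\mathbb{R}^d$ is a deterministic function, $F(w,z)\in\mathbb{R}^d$ is a direction (e.g. a gradient), $\eta_t$ is the step-size, and $\xi_t$ is an $\mathbb{R}^d$-valued noise with an absolutely continuous distribution. The initial point $W_0$ is independent of $(S,Z_1,\dots,Z_T)$, and the noises $\xi_1,\dots,\xi_T$ are mutually independent and independent of $(W_0,S,Z_1,\dots,Z_T)$; thus $P(W_{t+1}\mid W^t,Z^T,S)=P(W_{t+1}\mid W_t,Z_{t+1})$. Notation: $W^t=(W_1,\dots,W_t)$, $Z^t=(Z_1,\dots,Z_t)$, $\|x\|_1=\sum_i|x_i|$. *)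

theory Defs
  imports "HOL-Probability.Probability"
begin

section \<open>Maximal leakage\<close>

definition ln_ennreal :: "ennreal \<Rightarrow> ereal" where
  "ln_ennreal x =
     (if x = 0 then -\<infinity> else if x = \<infinity> then \<infinity> else ereal (ln (enn2real x)))"

text \<open>Renyi divergence of order infinity of P from Q: the logarithm of the P-essential supremum
  of dP/dQ, with the usual value \<open>\<infinity>\<close> if P is not absolutely continuous with respect to Q.
  P and Q are meant to be probability measures on the same measurable space.\<close>

definition renyi_divergence_inf :: "'a measure \<Rightarrow> 'a measure \<Rightarrow> ereal" where
  "renyi_divergence_inf P Q =
     (if absolutely_continuous Q P then ln_ennreal (esssup P (RN_deriv Q P)) else \<infinity>)"

text \<open>Maximal leakage from X to Y, as Sibson's mutual information of order infinity. The minimum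
  over all probability measures Q on the space of Y is written as an infimum.\<close>

definition maximal_leakage ::
  "'a measure \<Rightarrow> 'b measure \<Rightarrow> 'c measure \<Rightarrow> ('a \<Rightarrow> 'b) \<Rightarrow> ('a \<Rightarrow> 'c) \<Rightarrow> ereal" where
  "maximal_leakage M MX MY X Y =
     (INF Q \<in> {Q. prob_space Q \<and> sets Q = sets MY}.
        renyi_divergence_inf (distr M (MX \<Otimes>\<^sub>M MY) (\<lambda>\<omega>. (X \<omega>, Y \<omega>))) (distr M MX X \<Otimes>\<^sub>M Q))"


section \<open>Data, mini-batches and conditional probabilities\<close>

definition tuple :: "'i set \<Rightarrow> ('i \<Rightarrow> 'a \<Rightarrow> 'b) \<Rightarrow> 'a \<Rightarrow> 'i \<Rightarrow> 'b" where
  "tuple I X \<omega> = (\<lambda>i\<in>I. X i \<omega>)"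

text \<open>A mini-batch of a data set of n samples is a finite map: its domain is the set of
  (indices of) the samples it contains, and it maps each of these indices to the sample. Mini-batches
  whose domain is a fixed J carry the product sigma-algebra over J.\<close>

definition batch_space :: "nat \<Rightarrow> 'z measure \<Rightarrow> (nat \<Rightarrow>\<^sub>F 'z) measure" where
  "batch_space n D = Fin_Map.PiF (Pow {1..n}) (\<lambda>_. D)"

definition sub_batch :: "(nat \<Rightarrow>\<^sub>F 'z) \<Rightarrow> nat \<Rightarrow> (nat \<Rightarrow> 'z) \<Rightarrow> bool" where
  "sub_batch z n s \<longleftrightarrow> Fin_Map.domain z \<subseteq> {1..n} \<and> (\<forall>i\<in>Fin_Map.domain z. Fin_Map.proj z i = s i)"

text \<open>A version of the conditional probability of the event E given the random variable X with
  values in the measurable space N.\<close>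

definition cond_prob_given ::
  "'a measure \<Rightarrow> 'b measure \<Rightarrow> ('a \<Rightarrow> 'b) \<Rightarrow> 'a set \<Rightarrow> 'a \<Rightarrow> real" where
  "cond_prob_given M N X E = real_cond_exp M (vimage_algebra (space M) X N) (indicator E)"

text \<open>The library's \<open>indep_var\<close> requires both random variables to have the same value type.\<close>

definition indep_rvs ::
  "'a measure \<Rightarrow> 'b measure \<Rightarrow> ('a \<Rightarrow> 'b) \<Rightarrow> 'c measure \<Rightarrow> ('a \<Rightarrow> 'c) \<Rightarrow> bool" where
  "indep_rvs M MX X MY Y \<longleftrightarrow>
     X \<in> M \<rightarrow>\<^sub>M MX \<and> Y \<in> M \<rightarrow>\<^sub>M MY \<and>
     prob_space.indep_set M
       {X -` A \<inter> space M | A. A \<in> sets MX} {Y -` B \<inter> space M | B. B \<in> sets MY}"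


section \<open>Euclidean space\<close>

definition l1_norm :: "real ^ 'd \<Rightarrow> real" where
  "l1_norm x = (\<Sum>i\<in>UNIV. \<bar>x $ i\<bar>)"

text \<open>Lebesgue density of the normal distribution with mean 0 and covariance matrix
  \<open>\<sigma>\<^sup>2 I\<^sub>d\<close>, where d is the dimension \<open>CARD('d)\<close>.\<close>

definition isotropic_normal_density :: "real \<Rightarrow> real ^ 'd \<Rightarrow> real" where
  "isotropic_normal_density \<sigma> x =
     exp (- (norm x)\<^sup>2 / (2 * \<sigma>\<^sup>2)) / (2 * pi * \<sigma>\<^sup>2) powr (real CARD('d) / 2)"

text \<open>Volume of the L1-ball of radius r in dimension d.\<close>

definition V1 :: "nat \<Rightarrow> real \<Rightarrow> real" where
  "V1 d r = (2 * r) ^ d / fact d"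

end

theory Submission
  imports Defs
begin

text \<open>Put \<open>U\<^sub>t = W\<^sub>t - g(W\<^sub>t\<^sub>-\<^sub>1)\<close>. Given the initial point, the data, the mini-batches and the
  earlier noises, the law of \<open>U\<^sub>t\<close> is a Gaussian whose mean lies in the L1-ball of radius \<open>\<eta>\<^sub>t L\<close>, so its density is dominated
  by an envelope \<open>H\<^sub>t\<close> that depends neither on the data nor on the past. Hence the joint law of the
  data and the output is at most \<open>\<Prod>\<^sub>t \<integral>H\<^sub>t\<close> times the product of the law of the data with the law of the
  output of the data-free iteration \<open>W\<^sub>t = g(W\<^sub>t\<^sub>-\<^sub>1) + U\<^sub>t\<close>, where the \<open>U\<^sub>t\<close> are independent with density
  \<open>H\<^sub>t / \<integral>H\<^sub>t\<close>. This second law is an admissible \<open>Q\<close> in the definition of maximal leakage. Integrating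
  \<open>H\<^sub>t\<close>, a function of the L1-norm only, gives exactly the \<open>t\<close>-th term of the bound.\<close>

section \<open>Integrals of functions of the L1-norm\<close>

lemma nn_integral_lborel_abs:
  assumes [measurable]: "f \<in> borel_measurable borel"
  shows "(\<integral>\<^sup>+x. f \<bar>x::real\<bar> \<partial>lborel) = 2 * (\<integral>\<^sup>+x. f x * indicator {0..} x \<partial>lborel)"
proof -
  have "(\<integral>\<^sup>+x. f \<bar>x\<bar> \<partial>lborel) =
      (\<integral>\<^sup>+x. f x * indicator {0..} x + f (-x) * indicator {0<..} (-x) \<partial>lborel)"
    by (intro nn_integral_cong) (auto simp: indicator_def abs_if)
  also have "\<dots> = (\<integral>\<^sup>+x. f x * indicator {0..} x \<partial>lborel)
      + (\<integral>\<^sup>+x. f (-x) * indicator {0<..} (-x) \<partial>lborel)"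
    by (rule nn_integral_add) auto
  also have "(\<integral>\<^sup>+x. f (-x) * indicator {0<..} (-x) \<partial>lborel) = (\<integral>\<^sup>+x. f x * indicator {0<..} x \<partial>lborel)"
    using nn_integral_real_affine[of "\<lambda>x. f x * indicator {0<..} x" "-1" 0] by simp
  also have "\<dots> = (\<integral>\<^sup>+x. f x * indicator {0..} x \<partial>lborel)"
    using AE_lborel_singleton[of "0::real"]
    by (intro nn_integral_cong_AE) (auto simp: indicator_def elim!: eventually_mono)
  finally show ?thesis by (simp add: mult_2)
qed

text \<open>Substituting \<open>r = y + t\<close> and exchanging the integrals leaves the inner
  integral of \<open>(r - y) ^ k\<close> over \<open>0 \<le> y \<le> r\<close>, which is
  \<open>r ^ (k + 1) / (k + 1)\<close>. This is how one further coordinate raises the exponent in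
  the radial density of the L1-norm.\<close>

lemma nn_integral_convolution_power:
  fixes f :: "real \<Rightarrow> ennreal"
  assumes [measurable]: "f \<in> borel_measurable borel"
  shows "(\<integral>\<^sup>+y. (\<integral>\<^sup>+t. f (y + t) * ennreal (t ^ k) * indicator {0..} t \<partial>lborel) * indicator {0..} y \<partial>lborel)
    = ennreal (1 / real (k + 1)) * (\<integral>\<^sup>+r. f r * ennreal (r ^ (k + 1)) * indicator {0..} r \<partial>lborel)"
proof -
  have "(\<integral>\<^sup>+y. (\<integral>\<^sup>+t. f (y + t) * ennreal (t ^ k) * indicator {0..} t \<partial>lborel) * indicator {0..} y \<partial>lborel)
     = (\<integral>\<^sup>+y. (\<integral>\<^sup>+r. f r * ennreal ((r - y) ^ k) * indicator {0..} (r - y) * indicator {0..} y \<partial>lborel) \<partial>lborel)"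
  proof (intro nn_integral_cong)
    fix y :: real
    show "(\<integral>\<^sup>+t. f (y + t) * ennreal (t ^ k) * indicator {0..} t \<partial>lborel) * indicator {0..} y =
      (\<integral>\<^sup>+r. f r * ennreal ((r - y) ^ k) * indicator {0..} (r - y) * indicator {0..} y \<partial>lborel)"
      by (subst nn_integral_real_affine[of "\<lambda>r. f r * ennreal ((r - y) ^ k) * indicator {0..} (r - y) * indicator {0..} y" 1 y])
        (auto simp: nn_integral_multc)
  qed
  also have "\<dots> = (\<integral>\<^sup>+r. (\<integral>\<^sup>+y. f r * ennreal ((r - y) ^ k) * indicator {0..} (r - y) * indicator {0..} y \<partial>lborel) \<partial>lborel)"
    by (rule lborel_pair.Fubini') measurable
  also have "\<dots> = (\<integral>\<^sup>+r. ennreal (1 / (k + 1)) * (f r * ennreal (r ^ (k + 1)) * indicator {0..} r) \<partial>lborel)"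
  proof (intro nn_integral_cong)
    fix r :: real
    have "(\<integral>\<^sup>+y. f r * ennreal ((r - y) ^ k) * indicator {0..} (r - y) * indicator {0..} y \<partial>lborel)
      = (\<integral>\<^sup>+y. f r * (ennreal ((r - y) ^ k) * indicator {0..r} y) \<partial>lborel)"
      by (intro nn_integral_cong) (auto simp: indicator_def)
    also have "\<dots> = f r * (\<integral>\<^sup>+y. ennreal ((r - y) ^ k) * indicator {0..r} y \<partial>lborel)"
      by (rule nn_integral_cmult) measurable
    also have "(\<integral>\<^sup>+y. ennreal ((r - y) ^ k) * indicator {0..r} y \<partial>lborel)
      = ennreal (r ^ (k + 1) / (k + 1)) * indicator {0..} r"
    proof (cases "0 \<le> r")
      case True
      have "(\<integral>\<^sup>+y. ennreal ((r - y) ^ k) * indicator {0..r} y \<partial>lborel)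
        = ennreal (- ((r - r) ^ (k + 1) / (k + 1)) - - ((r - 0) ^ (k + 1) / (k + 1)))"
        by (rule nn_integral_FTC_Icc[OF _ _ _ True])
          (auto intro!: derivative_eq_intros simp del: power_Suc simp: divide_simps)
      then show ?thesis using True by simp
    qed (auto simp: indicator_def)
    also have "f r * (ennreal (r ^ (k + 1) / (k + 1)) * indicator {0..} r)
      = ennreal (1 / (k + 1)) * (f r * ennreal (r ^ (k + 1)) * indicator {0..} r)"
      by (cases "0 \<le> r") (simp_all add: ennreal_mult[symmetric] mult_ac del: power_Suc)
    finally show "(\<integral>\<^sup>+y. f r * ennreal ((r - y) ^ k) * indicator {0..} (r - y) * indicator {0..} y \<partial>lborel)
      = ennreal (1 / (k + 1)) * (f r * ennreal (r ^ (k + 1)) * indicator {0..} r)" .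
  qed
  also have "\<dots> = ennreal (1 / (k + 1)) * (\<integral>\<^sup>+r. f r * ennreal (r ^ (k + 1)) * indicator {0..} r \<partial>lborel)"
    by (rule nn_integral_cmult) measurable
  finally show ?thesis .
qed

text \<open>With d the number of coordinates, the simplex of nonnegative points with coordinate sum
  at most \<open>t\<close> has volume \<open>t ^ d / d!\<close>; its derivative
  \<open>t ^ (d - 1) / (d - 1)!\<close>, times the \<open>2 ^ d\<close> orthants, is the radial
  density. The induction adds one coordinate, and \<open>f\<close> is general because the induction
  hypothesis is applied to its translates by \<open>\<bar>y\<bar>\<close>. For empty
  \<open>I\<close> the left side would be the point value \<open>f 0\<close>.\<close>

lemma nn_integral_PiM_sum_abs:
  fixes f :: "real \<Rightarrow> ennreal"
  assumes "finite I" "I \<noteq> {}" "f \<in> borel_measurable borel"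
  shows "(\<integral>\<^sup>+x. f (\<Sum>i\<in>I. \<bar>x i\<bar>) \<partial>PiM I (\<lambda>_. lborel))
    = ennreal (2 ^ card I / fact (card I - 1))
      * (\<integral>\<^sup>+t. f t * ennreal (t ^ (card I - 1)) * indicator {0..} t \<partial>lborel)"
  using assms
proof (induction I arbitrary: f rule: finite_ne_induct)
  case (singleton i)
  note [measurable] = singleton.prems
  interpret product_sigma_finite "\<lambda>_. lborel :: real measure" by standard
  have "(\<integral>\<^sup>+x. f (\<Sum>i\<in>{i}. \<bar>x i\<bar>) \<partial>PiM {i} (\<lambda>_. lborel)) = (\<integral>\<^sup>+x. f \<bar>x\<bar> \<partial>lborel)"
    using product_nn_integral_singleton[of "\<lambda>x. f \<bar>x\<bar>" i] by simp
  then show ?case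
    by (simp add: nn_integral_lborel_abs)
next
  case (insert i I)
  note [measurable] = insert.prems
  \<comment> \<open>Since \<open>I\<close> is nonempty the subtraction is exact, so the exponent and
    the factorial in the induction hypothesis are those of \<open>k\<close>.\<close>
  define k where "k = card I - 1"
  have k: "card I = Suc k" using insert.hyps by (simp add: k_def card_gt_0_iff)
  interpret product_sigma_finite "\<lambda>_. lborel :: real measure" by standard
  have "(\<integral>\<^sup>+x. f (\<Sum>i\<in>insert i I. \<bar>x i\<bar>) \<partial>PiM (insert i I) (\<lambda>_. lborel))
     = (\<integral>\<^sup>+y. (\<integral>\<^sup>+x. f (\<Sum>j\<in>insert i I. \<bar>(x(i := y)) j\<bar>) \<partial>PiM I (\<lambda>_. lborel)) \<partial>lborel)"
    by (rule product_nn_integral_insert_rev) (use insert in \<open>auto\<close>)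
  also have "\<dots> = (\<integral>\<^sup>+y. (\<integral>\<^sup>+x. f (\<bar>y\<bar> + (\<Sum>j\<in>I. \<bar>x j\<bar>)) \<partial>PiM I (\<lambda>_. lborel)) \<partial>lborel)"
  proof -
    have "(\<Sum>j\<in>insert i I. \<bar>(x(i := y)) j\<bar>) = \<bar>y\<bar> + (\<Sum>j\<in>I. \<bar>x j\<bar>)" for x and y :: real
      
      using insert.hyps by simp (intro sum.cong, auto)
    then show ?thesis by simp
  qed
  also have "\<dots> = (\<integral>\<^sup>+y. ennreal (2 ^ Suc k / fact k)
      * (\<integral>\<^sup>+t. f (\<bar>y\<bar> + t) * ennreal (t ^ k) * indicator {0..} t \<partial>lborel) \<partial>lborel)"
  proof (intro nn_integral_cong)
    fix y :: real
    show "(\<integral>\<^sup>+x. f (\<bar>y\<bar> + (\<Sum>j\<in>I. \<bar>x j\<bar>)) \<partial>PiM I (\<lambda>_. lborel)) = ennreal (2 ^ Suc k / fact k)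
      * (\<integral>\<^sup>+t. f (\<bar>y\<bar> + t) * ennreal (t ^ k) * indicator {0..} t \<partial>lborel)"
      using insert.IH[of "\<lambda>t. f (\<bar>y\<bar> + t)"] k by simp
  qed
  \<comment> \<open>The two signs of the new coordinate give the factor 2; the convolution then
    contributes \<open>1 / (k + 1)\<close>, which completes \<open>k!\<close> to
    \<open>(k + 1)!\<close>.\<close>
  also have "\<dots> = ennreal (2 ^ Suc k / fact k) * (2 * (\<integral>\<^sup>+y.
      (\<integral>\<^sup>+t. f (y + t) * ennreal (t ^ k) * indicator {0..} t \<partial>lborel) * indicator {0..} y \<partial>lborel))"
    by (subst nn_integral_cmult, measurable) (subst nn_integral_lborel_abs, auto)
  also have "\<dots> = ennreal (2 ^ Suc k / fact k) * (2 * (ennreal (1 / (k + 1)) *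
      (\<integral>\<^sup>+r. f r * ennreal (r ^ (k + 1)) * indicator {0..} r \<partial>lborel)))"
    by (subst nn_integral_convolution_power) auto
  also have "\<dots> = (ennreal (2 ^ Suc k / fact k) * ennreal 2 * ennreal (1 / (k + 1))) *
      (\<integral>\<^sup>+r. f r * ennreal (r ^ (k + 1)) * indicator {0..} r \<partial>lborel)"
    by (simp add: mult.assoc)
  also have "ennreal (2 ^ Suc k / fact k) * ennreal 2 * ennreal (1 / (k + 1))
      = ennreal (2 ^ Suc (Suc k) / fact (Suc k))"
    by (simp only: ennreal_mult[symmetric] divide_nonneg_nonneg zero_le_power fact_ge_zero zero_le_numeral
         of_nat_0_le_iff zero_le_one mult_nonneg_nonneg) (simp add: field_simps)
  finally show ?case using insert.hyps k by simp
qed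

text \<open>Expresses the norm in the coordinates in which \<open>lborel\<close> is a product
  measure.\<close>

lemma l1_norm_eq_sum_Basis: "l1_norm (x :: real ^ 'd) = (\<Sum>b\<in>Basis. \<bar>x \<bullet> b\<bar>)"
proof -
  have "(\<Sum>b\<in>Basis. \<bar>x \<bullet> b\<bar>) = (\<Sum>b\<in>range (\<lambda>i. axis i (1::real)). \<bar>x \<bullet> b\<bar>)"
    by (rule sum.cong) (auto simp: Basis_vec_def)
  also have "\<dots> = (\<Sum>i\<in>UNIV. \<bar>x \<bullet> axis i 1\<bar>)"
    by (subst sum.reindex) (auto simp: inj_on_def axis_eq_axis)
  finally show ?thesis by (simp add: l1_norm_def inner_axis)
qed

lemma borel_measurable_l1_norm [measurable]: "l1_norm \<in> borel_measurable borel"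
  unfolding l1_norm_eq_sum_Basis by measurable

lemma nn_integral_lborel_l1_norm:
  assumes [measurable]: "f \<in> borel_measurable borel"
  shows "(\<integral>\<^sup>+x. f (l1_norm (x :: real ^ 'd)) \<partial>lborel) = ennreal (2 ^ CARD('d) / fact (CARD('d) - 1))
      * (\<integral>\<^sup>+t. f t * ennreal (t ^ (CARD('d) - 1)) * indicator {0..} t \<partial>lborel)"
proof -
  have eq: "l1_norm (\<Sum>b\<in>Basis. x b *\<^sub>R b :: real ^ 'd) = (\<Sum>b\<in>Basis. \<bar>x b\<bar>)" for x
    unfolding l1_norm_eq_sum_Basis by (intro sum.cong refl) simp
  have "(\<integral>\<^sup>+x. f (l1_norm (x :: real ^ 'd)) \<partial>lborel)
      = (\<integral>\<^sup>+x. f (l1_norm (\<Sum>b\<in>Basis. x b *\<^sub>R b :: real ^ 'd)) \<partial>PiM Basis (\<lambda>_. lborel))"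
    by (subst lborel_eq, subst nn_integral_distr) auto
  also have "\<dots> = (\<integral>\<^sup>+x. f (\<Sum>b\<in>(Basis :: (real ^ 'd) set). \<bar>x b\<bar>) \<partial>PiM Basis (\<lambda>_. lborel))"
    by (simp only: eq)
  also have "\<dots> = ennreal (2 ^ card (Basis :: (real ^ 'd) set) / fact (card (Basis :: (real ^ 'd) set) - 1))
      * (\<integral>\<^sup>+t. f t * ennreal (t ^ (card (Basis :: (real ^ 'd) set) - 1)) * indicator {0..} t \<partial>lborel)"
    by (rule nn_integral_PiM_sum_abs) auto
  finally show ?thesis by simp
qed

text \<open>Links the factorial form of the even Gaussian moments to the Gamma values in the bound.
  The induction is the functional equation \<open>Gamma (x + 1) = x * Gamma x\<close>, started at
  \<open>Gamma (1 / 2) = sqrt pi\<close>.\<close>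

lemma Gamma_half_odd: "Gamma (real (2 * k + 1) / 2) = sqrt pi * fact (2 * k) / (2 ^ (2 * k) * fact k)"
proof (induction k)
  case 0
  show ?case by (simp add: Gamma_one_half_real)
next
  case (Suc k)
  have "Gamma (real (2 * Suc k + 1) / 2) = Gamma (real (2 * k + 1) / 2 + 1)"
    by (rule arg_cong[where f = Gamma]) (simp add: field_simps)
  also have "\<dots> = real (2 * k + 1) / 2 * Gamma (real (2 * k + 1) / 2)"
    by (rule Gamma_plus1) (auto simp: nonpos_Ints_def)
  also have "\<dots> = real (2 * k + 1) * (2 * (real k + 1)) * sqrt pi * fact (2 * k)
      / (2 ^ (2 * k) * 4 * ((real k + 1) * fact k))"
    unfolding Suc.IH by (simp add: divide_simps)
  also have "\<dots> = sqrt pi * fact (2 * Suc k) / (2 ^ (2 * Suc k) * fact (Suc k))"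
    by (simp add: algebra_simps)
  finally show ?case .
qed

text \<open>The even and odd half-line moments have different closed forms; both are rewritten as
  Gamma values, so that the binomial sum below needs no case distinction on parity.\<close>

lemma nn_integral_gaussian_moment_pos:
  "(\<integral>\<^sup>+x. ennreal (exp (- x\<^sup>2) * x ^ i) * indicator {0..} x \<partial>lborel) = ennreal (Gamma ((real i + 1) / 2) / 2)"
proof -
  have "has_bochner_integral lborel (\<lambda>x. indicator {0..} x *\<^sub>R (exp (- x\<^sup>2) * x ^ i)) (Gamma ((real i + 1) / 2) / 2)"
  proof (cases "even i")
    case True
    then obtain k where i: "i = 2 * k" by auto
    have "Gamma ((real i + 1) / 2) / 2 = sqrt pi / 2 * (fact (2 * k) / (2 ^ (2 * k) * fact k))"
      using Gamma_half_odd[of k] by (simp add: i add.commute)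
    then show ?thesis using gaussian_moment_even_pos[of k] by (simp only: i)
  next
    case False
    then obtain k where i: "i = 2 * k + 1" by (auto elim: oddE)
    have "(real i + 1) / 2 = 1 + real k" by (simp add: i)
    then have "Gamma ((real i + 1) / 2) / 2 = fact k / 2" by (simp only: Gamma_fact)
    then show ?thesis using gaussian_moment_odd_pos[of k] by (simp only: i)
  qed
  then have "(\<integral>\<^sup>+x. ennreal (indicator {0..} x *\<^sub>R (exp (- x\<^sup>2) * x ^ i)) \<partial>lborel) = ennreal (Gamma ((real i + 1) / 2) / 2)"
    by (subst nn_integral_eq_integral) (auto simp: has_bochner_integral_iff indicator_def)
  then show ?thesis
    by (subst (asm) nn_integral_cong[where v = "\<lambda>x. ennreal (exp (- x\<^sup>2) * x ^ i) * indicator {0..} x"])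
      (auto simp: indicator_def)
qed

text \<open>On \<open>[0, r]\<close> the exponential is 1 and the integral is elementary. Beyond
  \<open>r\<close>, the substitution \<open>t = r + a * s\<close> and the binomial expansion of
  \<open>(r + a * s) ^ k\<close> reduce the tail to half-line Gaussian moments.\<close>

lemma nn_integral_shifted_gaussian:
  fixes r a :: real
  assumes "0 < r" "0 < a"
  shows "(\<integral>\<^sup>+t. ennreal (exp (- (max 0 (t - r) / a)\<^sup>2)) * ennreal (t ^ k) * indicator {0..} t \<partial>lborel)
    = ennreal (r ^ (k + 1) / real (k + 1)
        + a / 2 * (\<Sum>i\<le>k. real (k choose i) * a ^ i * r ^ (k - i) * Gamma ((real i + 1) / 2)))"
proof -
  have [simp]: "0 \<le> Gamma ((real i + 1) / 2)" for i
    by (intro less_imp_le Gamma_real_pos) simp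
  let ?g = "\<lambda>t. ennreal (exp (- ((t - r) / a)\<^sup>2) * t ^ k) * indicator {r..} t"
  have "(\<integral>\<^sup>+t. ennreal (exp (- (max 0 (t - r) / a)\<^sup>2)) * ennreal (t ^ k) * indicator {0..} t \<partial>lborel)
    = (\<integral>\<^sup>+t. ennreal (t ^ k) * indicator {0..r} t + ?g t \<partial>lborel)"
    \<comment> \<open>The two pieces overlap in the point \<open>r\<close>, so the integrands agree
      only almost everywhere.\<close>
    using AE_lborel_singleton[of r] assms
    by (intro nn_integral_cong_AE)
      (auto simp: indicator_def max_def ennreal_mult elim!: eventually_mono)
  also have "\<dots> = (\<integral>\<^sup>+t. ennreal (t ^ k) * indicator {0..r} t \<partial>lborel) + (\<integral>\<^sup>+t. ?g t \<partial>lborel)"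
    by (rule nn_integral_add) auto
  also have "(\<integral>\<^sup>+t. ennreal (t ^ k) * indicator {0..r} t \<partial>lborel)
      = ennreal (r ^ (k + 1) / real (k + 1) - 0 ^ (k + 1) / real (k + 1))"
    by (rule nn_integral_FTC_Icc)
      (use assms in \<open>auto intro!: derivative_eq_intros simp del: power_Suc simp: divide_simps\<close>)
  also have "(\<integral>\<^sup>+t. ?g t \<partial>lborel) = ennreal a * (\<integral>\<^sup>+s. ?g (r + a * s) \<partial>lborel)"
    using nn_integral_real_affine[of ?g a r] assms by simp
  also have "(\<integral>\<^sup>+s. ?g (r + a * s) \<partial>lborel) = (\<integral>\<^sup>+s. (\<Sum>i\<le>k. ennreal (real (k choose i) * a ^ i * r ^ (k - i))
        * (ennreal (exp (- s\<^sup>2) * s ^ i) * indicator {0..} s)) \<partial>lborel)"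
  proof (intro nn_integral_cong)
    fix s :: real
    show "?g (r + a * s) = (\<Sum>i\<le>k. ennreal (real (k choose i) * a ^ i * r ^ (k - i))
        * (ennreal (exp (- s\<^sup>2) * s ^ i) * indicator {0..} s))"
    proof (cases "0 \<le> s")
      case True
      have "exp (- s\<^sup>2) * (r + a * s) ^ k
          = (\<Sum>i\<le>k. real (k choose i) * a ^ i * r ^ (k - i) * (exp (- s\<^sup>2) * s ^ i))"
        by (subst add.commute, subst binomial_ring)
          (simp add: sum_distrib_left power_mult_distrib mult_ac)
      then show ?thesis using True assms
        by (simp add: ennreal_mult[symmetric] sum_ennreal)
    next
      case False
      then show ?thesis using assms by (simp add: indicator_def zero_le_mult_iff)
    qed
  qed
  also have "\<dots> = (\<Sum>i\<le>k. ennreal (real (k choose i) * a ^ i * r ^ (k - i)) * ennreal (Gamma ((real i + 1) / 2) / 2))"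
    by (subst nn_integral_sum, simp, intro sum.cong refl, subst nn_integral_cmult)
      (simp_all only: nn_integral_gaussian_moment_pos, simp)
  also have "\<dots> = ennreal (\<Sum>i\<le>k. real (k choose i) * a ^ i * r ^ (k - i) * (Gamma ((real i + 1) / 2) / 2))"
    using assms by (simp add: ennreal_mult[symmetric] sum_ennreal)
  finally show ?thesis
    using assms by (simp add: ennreal_mult[symmetric] ennreal_plus[symmetric] sum_nonneg sum_distrib_left mult_ac
         del: ennreal_plus power_Suc)
qed

section \<open>The Gaussian envelope\<close>

text \<open>A bound for the essential supremum of the density of a Gaussian over all means in the
  L1-ball of radius \<open>r\<close>. The slack lies only in replacing the Euclidean norm by \<open>l1_norm / sqrt d\<close>.\<close>

definition gaussian_envelope :: "real \<Rightarrow> real \<Rightarrow> real ^ 'd \<Rightarrow> real" where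
  "gaussian_envelope r \<sigma> x =
     exp (- (max 0 (l1_norm x - r) / (\<sigma> * sqrt (2 * real CARD('d))))\<^sup>2) / (2 * pi * \<sigma>\<^sup>2) powr (real CARD('d) / 2)"

text \<open>The argument of the logarithm in the theorem, with \<open>r\<close> in place of
  \<open>\<eta> t * L\<close>. It is the total integral of the envelope, as
  \<open>nn_integral_gaussian_envelope\<close> shows.\<close>

definition envelope_mass :: "nat \<Rightarrow> real \<Rightarrow> real \<Rightarrow> real" where
  "envelope_mass d r \<sigma> =
     V1 d r / (2 * pi * \<sigma>\<^sup>2) powr (real d / 2)
     + (2 * r) ^ (d - 1) * (\<sigma> * sqrt (2 * real d)) / ((2 * pi * \<sigma>\<^sup>2) powr (real d / 2) * fact (d - 1))
       * (\<Sum>i = 0..d - 1. real (d - 1 choose i) * (\<sigma> * sqrt (2 * real d) / r) ^ i * Gamma ((real i + 1) / 2))"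

text \<open>The volume term is strictly positive and the Gamma sum is nonnegative. Positivity allows
  the envelope to be normalised and the logarithm to be taken.\<close>

lemma envelope_mass_pos:
  assumes "0 < r" "0 < \<sigma>" "0 < d"
  shows "0 < envelope_mass d r \<sigma>"
proof -
  have "0 \<le> Gamma ((real i + 1) / 2)" for i
    by (intro less_imp_le Gamma_real_pos) simp
  then show ?thesis unfolding envelope_mass_def V1_def using assms
    by (intro add_pos_nonneg mult_nonneg_nonneg sum_nonneg) auto
qed

lemma borel_measurable_gaussian_envelope [measurable]: "gaussian_envelope r \<sigma> \<in> borel_measurable borel"
  unfolding gaussian_envelope_def by measurable

lemma gaussian_envelope_nonneg: "0 \<le> gaussian_envelope r \<sigma> x"
  by (simp add: gaussian_envelope_def)

text \<open>Radial integration leaves the shifted Gaussian integral with exponent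
  \<open>d - 1\<close> and scale \<open>a = \<sigma> * sqrt (2 * d)\<close>. Its elementary part
  becomes the volume of the L1-ball, its tail the Gamma sum; the factor \<open>1 / 2\<close> of the
  tail turns \<open>2 ^ d\<close> into \<open>2 ^ (d - 1)\<close>.\<close>

lemma nn_integral_gaussian_envelope:
  assumes "0 < r" "0 < \<sigma>"
  shows "(\<integral>\<^sup>+x. ennreal (gaussian_envelope r \<sigma> (x :: real ^ 'd)) \<partial>lborel) = ennreal (envelope_mass CARD('d) r \<sigma>)"
proof -
  define d k a P where "d = CARD('d)" and "k = d - 1" and "a = \<sigma> * sqrt (2 * real d)"
    and "P = (2 * pi * \<sigma>\<^sup>2) powr (real d / 2)"
  have d: "d = Suc k" by (simp add: k_def d_def)
  have a: "0 < a" using assms d by (simp add: a_def)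
  have P: "0 < P" using assms by (simp add: P_def)
  have G: "0 \<le> Gamma ((real i + 1) / 2)" for i
    by (intro less_imp_le Gamma_real_pos) simp
  define I where "I = r ^ (k + 1) / real (k + 1)
      + a / 2 * (\<Sum>i\<le>k. real (k choose i) * a ^ i * r ^ (k - i) * Gamma ((real i + 1) / 2))"
  have I: "0 \<le> I" unfolding I_def using assms a G
    by (intro add_nonneg_nonneg mult_nonneg_nonneg sum_nonneg) auto
  have "(\<integral>\<^sup>+x. ennreal (gaussian_envelope r \<sigma> (x :: real ^ 'd)) \<partial>lborel)
      = (\<integral>\<^sup>+x. ennreal (1 / P) * ennreal (exp (- (max 0 (l1_norm (x :: real ^ 'd) - r) / a)\<^sup>2)) \<partial>lborel)"
    using P unfolding gaussian_envelope_def P_def a_def d_def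
    by (intro nn_integral_cong) (simp add: ennreal_mult[symmetric])
  also have "\<dots> = ennreal (1 / P) * (\<integral>\<^sup>+x. ennreal (exp (- (max 0 (l1_norm (x :: real ^ 'd) - r) / a)\<^sup>2)) \<partial>lborel)"
    by (rule nn_integral_cmult) measurable
  also have "(\<integral>\<^sup>+x. ennreal (exp (- (max 0 (l1_norm (x :: real ^ 'd) - r) / a)\<^sup>2)) \<partial>lborel)
      = ennreal (2 ^ d / fact k) * ennreal I"
    by (subst nn_integral_lborel_l1_norm, measurable)
      (simp only: d_def[symmetric] k_def[symmetric] nn_integral_shifted_gaussian[OF assms(1) a] I_def)
  also have "ennreal (1 / P) * (ennreal (2 ^ d / fact k) * ennreal I) = ennreal (1 / P * (2 ^ d / fact k * I))"
    using P I by (simp add: ennreal_mult[symmetric])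
  also have "1 / P * (2 ^ d / fact k * I) = envelope_mass d r \<sigma>"
  proof -
    \<comment> \<open>Pulling \<open>r ^ k\<close> out of the binomial sum turns
      \<open>a ^ i * r ^ (k - i)\<close> into \<open>(a / r) ^ i\<close>, the form in the stated
      bound.\<close>
    define X where "X = (\<Sum>i = 0..k. real (k choose i) * (a / r) ^ i * Gamma ((real i + 1) / 2))"
    have "(\<Sum>i\<le>k. real (k choose i) * a ^ i * r ^ (k - i) * Gamma ((real i + 1) / 2)) = r ^ k * X"
      unfolding X_def sum_distrib_left atMost_atLeast0 using assms
      by (intro sum.cong refl) (simp add: power_diff power_divide)
    then have I': "I = r ^ (k + 1) / real (k + 1) + a / 2 * (r ^ k * X)"
      by (simp add: I_def)
    have em: "envelope_mass d r \<sigma> = (2 * r) ^ d / fact d / P + (2 * r) ^ k * a / (P * fact k) * X"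
      by (simp add: X_def envelope_mass_def V1_def P_def a_def k_def)
    \<comment> \<open>The factorial of \<open>d\<close> is \<open>m * q\<close>, so what remains is
      an identity of rational expressions.\<close>
    define q m where "q = (fact k :: real)" and "m = real k + 1"
    have q: "0 < q" and m: "0 < m" by (simp_all add: q_def m_def)
    have "1 / P * (2 * 2 ^ k / q * (r * r ^ k / m + a / 2 * (r ^ k * X)))
      = 2 * r * (2 ^ k * r ^ k) / (m * q) / P + 2 ^ k * r ^ k * a / (P * q) * X"
      using P q m by (simp add: field_simps)
    then show ?thesis unfolding em I' unfolding d
      by (simp add: q_def m_def power_mult_distrib add.commute)
  qed
  finally show ?thesis by (simp add: d_def)
qed

lemma l1_norm_triangle_diff: "l1_norm u - l1_norm b \<le> l1_norm (u + b)"
proof -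
  have "l1_norm u \<le> l1_norm (u + b) + l1_norm b"
    unfolding l1_norm_def sum.distrib[symmetric] by (intro sum_mono) simp
  then show ?thesis by simp
qed

text \<open>Cauchy-Schwarz against the all-ones vector.\<close>

lemma l1_norm_squared_le: "(l1_norm (x :: real ^ 'd))\<^sup>2 \<le> real CARD('d) * (norm x)\<^sup>2"
  using sum_squared_le_sum_of_squares[of "\<lambda>i. \<bar>x $ i\<bar>" "UNIV :: 'd set"]
  by (simp add: l1_norm_def norm_vec_def L2_set_def sum_nonneg mult.commute)

text \<open>By the reverse triangle inequality, \<open>u + b\<close> has L1-norm at least
  \<open>l1_norm u - r\<close>, and Cauchy-Schwarz passes to the Euclidean norm at the cost of the
  dimension. The scale \<open>\<sigma> * sqrt (2 * d)\<close> of the envelope absorbs that cost.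
  Here \<open>-b\<close> is the mean of the increment and \<open>u + b\<close> is the noise that
  produces the increment \<open>u\<close>.\<close>

lemma isotropic_normal_density_le_envelope:
  fixes u b :: "real ^ 'd"
  assumes "l1_norm b \<le> r" "0 < \<sigma>"
  shows "isotropic_normal_density \<sigma> (u + b) \<le> gaussian_envelope r \<sigma> u"
proof -
  have "max 0 (l1_norm u - r) \<le> l1_norm (u + b)"
    using l1_norm_triangle_diff[of u b] assms(1) by (auto simp: l1_norm_def intro: sum_nonneg)
  then have "(max 0 (l1_norm u - r))\<^sup>2 \<le> (l1_norm (u + b))\<^sup>2"
    by (intro power_mono) auto
  also have "\<dots> \<le> real CARD('d) * (norm (u + b))\<^sup>2" by (rule l1_norm_squared_le)
  finally have "(max 0 (l1_norm u - r) / (\<sigma> * sqrt (2 * real CARD('d))))\<^sup>2 \<le> (norm (u + b))\<^sup>2 / (2 * \<sigma>\<^sup>2)"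
    using assms(2) by (simp add: power_divide power_mult_distrib divide_le_eq) (simp add: mult.commute)
  then show ?thesis
    unfolding isotropic_normal_density_def gaussian_envelope_def
    by (intro divide_right_mono) auto
qed

definition envelope_distr :: "real \<Rightarrow> real \<Rightarrow> (real ^ 'd) measure" where
  "envelope_distr r \<sigma> = density lborel (\<lambda>x. ennreal (gaussian_envelope r \<sigma> x / envelope_mass CARD('d) r \<sigma>))"

lemma sets_envelope_distr [simp, measurable_cong]: "sets (envelope_distr r \<sigma>) = sets borel"
  by (simp add: envelope_distr_def)

text \<open>The mass stands on the left so that it appears later as the multiplicative price of
  replacing a Gaussian step by a data-free one.\<close>

lemma nn_integral_envelope_distr:
  assumes "0 < r" "0 < \<sigma>" and [measurable]: "k \<in> borel_measurable borel"
  shows "ennreal (envelope_mass CARD('d) r \<sigma>) * (\<integral>\<^sup>+u. k u \<partial>envelope_distr r \<sigma>)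
    = (\<integral>\<^sup>+u. ennreal (gaussian_envelope r \<sigma> (u :: real ^ 'd)) * k u \<partial>lborel)"
proof -
  have pos: "0 < envelope_mass CARD('d) r \<sigma>" using assms by (intro envelope_mass_pos) auto
  have "ennreal (gaussian_envelope r \<sigma> u) = ennreal (envelope_mass CARD('d) r \<sigma>)
      * ennreal (gaussian_envelope r \<sigma> u / envelope_mass CARD('d) r \<sigma>)" for u :: "real ^ 'd"
    using pos by (simp add: ennreal_mult[symmetric] gaussian_envelope_nonneg)
  then show ?thesis unfolding envelope_distr_def
    by (subst nn_integral_density, measurable) (simp add: nn_integral_cmult[symmetric] mult.assoc)
qed

lemma prob_space_envelope_distr:
  assumes "0 < r" "0 < \<sigma>"
  shows "prob_space (envelope_distr r \<sigma> :: (real ^ 'd) measure)"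
proof (rule prob_spaceI)
  have pos: "0 < envelope_mass CARD('d) r \<sigma>" using assms by (intro envelope_mass_pos) auto
  have "ennreal (envelope_mass CARD('d) r \<sigma>) * emeasure (envelope_distr r \<sigma> :: (real ^ 'd) measure) (space (envelope_distr r \<sigma>))
      = ennreal (envelope_mass CARD('d) r \<sigma>) * 1"
    using nn_integral_envelope_distr[OF assms, where 'd = 'd and k = "\<lambda>_. 1"]
      nn_integral_gaussian_envelope[OF assms, where 'd = 'd] by simp
  then show "emeasure (envelope_distr r \<sigma> :: (real ^ 'd) measure) (space (envelope_distr r \<sigma>)) = 1"
    using pos by (subst (asm) ennreal_mult_cancel_left) auto
qed

text \<open>One step of the comparison: \<open>w\<close> stands for the value of \<open>g\<close> at
  the previous iterate and \<open>b\<close> for the scaled direction. The increment is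
  \<open>u = y - b\<close>; translation invariance moves the shift from the test function
  \<open>k\<close> into the density, where the envelope dominates it uniformly in
  \<open>b\<close>.\<close>

lemma nn_integral_shifted_normal_le:
  fixes w b :: "real ^ 'd"
  assumes "l1_norm b \<le> r" "0 < r" "0 < \<sigma>" and [measurable]: "k \<in> borel_measurable borel"
  shows "(\<integral>\<^sup>+y. ennreal (isotropic_normal_density \<sigma> y) * k (w - b + y) \<partial>lborel)
    \<le> ennreal (envelope_mass CARD('d) r \<sigma>) * (\<integral>\<^sup>+u. k (w + u) \<partial>envelope_distr r \<sigma>)"
proof -
  have [measurable]: "isotropic_normal_density \<sigma> \<in> borel_measurable (borel :: (real ^ 'd) measure)"
    unfolding isotropic_normal_density_def by measurable
  have "(\<integral>\<^sup>+y. ennreal (isotropic_normal_density \<sigma> y) * k (w - b + y) \<partial>lborel)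
      = (\<integral>\<^sup>+y. ennreal (isotropic_normal_density \<sigma> y) * k (w - b + y) \<partial>distr lborel borel ((+) b))"
    by (simp add: lborel_distr_plus)
  also have "\<dots> = (\<integral>\<^sup>+u. ennreal (isotropic_normal_density \<sigma> (u + b)) * k (w + u) \<partial>lborel)"
    by (subst nn_integral_distr) (auto simp: add.commute)
  also have "\<dots> \<le> (\<integral>\<^sup>+u. ennreal (gaussian_envelope r \<sigma> u) * k (w + u) \<partial>lborel)"
    using assms by (intro nn_integral_mono mult_right_mono ennreal_leI isotropic_normal_density_le_envelope) auto
  also have "\<dots> = ennreal (envelope_mass CARD('d) r \<sigma>) * (\<integral>\<^sup>+u. k (w + u) \<partial>envelope_distr r \<sigma>)"
    using assms by (subst nn_integral_envelope_distr) auto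
  finally show ?thesis .
qed

section \<open>Iterations driven by independent noise\<close>

text \<open>One recursion serves both processes: with drift
  \<open>g w - \<eta> t *\<^sub>R F w (z t)\<close> it is the algorithm with its mini-batches
  frozen, with drift \<open>g\<close> it is the data-free iteration.\<close>

primrec noisy_iterate :: "(nat \<Rightarrow> 'v \<Rightarrow> 'v) \<Rightarrow> 'v \<Rightarrow> (nat \<Rightarrow> 'v) \<Rightarrow> nat \<Rightarrow> 'v::plus" where
  "noisy_iterate b w u 0 = w"
| "noisy_iterate b w u (Suc t) = b (Suc t) (noisy_iterate b w u t) + u (Suc t)"

lemma noisy_iterate_cong:
  "(\<And>i. i \<in> {1..t} \<Longrightarrow> u i = v i) \<Longrightarrow> noisy_iterate b w u t = noisy_iterate b w v t"
  by (induction t) auto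

text \<open>Drift, start and noise may all depend on the parameter \<open>x\<close>. Each iterate is
  fed back into the drift, so the drift must be jointly measurable in the parameter and the
  state.\<close>

lemma measurable_noisy_iterate:
  fixes w :: "'a \<Rightarrow> 'v::{second_countable_topology, real_normed_vector}"
  assumes "\<And>i. i \<in> {1..t} \<Longrightarrow> (\<lambda>(x, w). b x i w) \<in> N \<Otimes>\<^sub>M borel \<rightarrow>\<^sub>M borel"
    and [measurable]: "w \<in> N \<rightarrow>\<^sub>M borel"
    and "\<And>i. i \<in> {1..t} \<Longrightarrow> (\<lambda>x. u x i) \<in> N \<rightarrow>\<^sub>M borel"
  shows "(\<lambda>x. noisy_iterate (b x) (w x) (u x) t) \<in> N \<rightarrow>\<^sub>M borel"
  using assms(1,3)
proof (induction t)
  case 0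
  then show ?case by simp
next
  case (Suc t)
  have [measurable]: "(\<lambda>x. noisy_iterate (b x) (w x) (u x) t) \<in> N \<rightarrow>\<^sub>M borel"
    by (rule Suc.IH) (use Suc.prems in auto)
  have [measurable]: "(\<lambda>(x, w). b x (Suc t) w) \<in> N \<Otimes>\<^sub>M borel \<rightarrow>\<^sub>M borel" "(\<lambda>x. u x (Suc t)) \<in> N \<rightarrow>\<^sub>M borel"
    using Suc.prems by auto
  have "(\<lambda>x. (\<lambda>(x, w). b x (Suc t) w) (x, noisy_iterate (b x) (w x) (u x) t)) \<in> N \<rightarrow>\<^sub>M borel"
    by measurable
  then show ?case by simp
qed

text \<open>The last noise is integrated first, with the past fixed: the one-step bound replaces the
  last step of the first process by that of the second at cost \<open>C (Suc T)\<close>. The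
  induction hypothesis, applied to the resulting functional of the shorter path, replaces the
  earlier steps. Test functions of the whole path are used because the output may depend on all
  iterates.\<close>

lemma nn_integral_noisy_iterate_le:
  fixes \<nu> \<mu> :: "nat \<Rightarrow> 'v::{second_countable_topology, real_normed_vector} measure"
  assumes \<nu>: "\<And>t. prob_space (\<nu> t)" "\<And>t. sets (\<nu> t) = sets borel"
    and \<mu>: "\<And>t. prob_space (\<mu> t)" "\<And>t. sets (\<mu> t) = sets borel"
    and b: "\<And>t. t \<in> {1..T} \<Longrightarrow> b t \<in> borel \<rightarrow>\<^sub>M borel"
    and c: "\<And>t. t \<in> {1..T} \<Longrightarrow> c t \<in> borel \<rightarrow>\<^sub>M borel"
    and step: "\<And>t w k. t \<in> {1..T} \<Longrightarrow> k \<in> borel_measurable borel \<Longrightarrow>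
      (\<integral>\<^sup>+y. k (b t w + y) \<partial>\<nu> t) \<le> C t * (\<integral>\<^sup>+u. k (c t w + u) \<partial>\<mu> t)"
    and f: "f \<in> borel_measurable (PiM {1..T} (\<lambda>_. borel))"
  shows "(\<integral>\<^sup>+\<xi>. f (\<lambda>i\<in>{1..T}. noisy_iterate b w \<xi> i) \<partial>PiM {1..T} \<nu>)
    \<le> (\<Prod>t=1..T. C t) * (\<integral>\<^sup>+u. f (\<lambda>i\<in>{1..T}. noisy_iterate c w u i) \<partial>PiM {1..T} \<mu>)"
  using b c step f
proof (induction T arbitrary: f)
  case 0
  interpret P: prob_space "PiM {1..0::nat} \<nu>" by (intro prob_space_PiM \<nu>)
  interpret Q: prob_space "PiM {1..0::nat} \<mu>" by (intro prob_space_PiM \<mu>)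
  show ?case using P.emeasure_space_1 Q.emeasure_space_1 by (simp add: restrict_def)
next
  case (Suc T)
  note [measurable_cong] = \<nu>(2) \<mu>(2)
  note [measurable] = Suc.prems(4)
  have c' [measurable]: "c (Suc T) \<in> borel \<rightarrow>\<^sub>M borel"
    using Suc.prems by auto
  interpret P: product_sigma_finite \<nu>
    using \<nu> by (simp add: product_sigma_finite_def prob_space_imp_sigma_finite)
  interpret Q: product_sigma_finite \<mu>
    using \<mu> by (simp add: product_sigma_finite_def prob_space_imp_sigma_finite)
  interpret \<mu>: prob_space "\<mu> (Suc T)" by (rule \<mu>)
  have prod_Suc: "(\<Prod>t=1..Suc T. C t) = C (Suc T) * (\<Prod>t=1..T. C t)" by (simp add: mult.commute)
  have I: "{1..Suc T} = insert (Suc T) {1..T}" by auto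
  have sets_PiM [measurable_cong]: "sets (PiM J \<nu>) = sets (PiM J (\<lambda>_. borel))"
      "sets (PiM J \<mu>) = sets (PiM J (\<lambda>_. borel))" for J
    by (auto intro!: sets_PiM_cong simp: \<nu> \<mu>)
  \<comment> \<open>For \<open>T = 0\<close> the path is empty and the latest state is the starting
    point \<open>w\<close>.\<close>
  define last where "last p = (if T = 0 then w else p T)" for p :: "nat \<Rightarrow> 'v"
  have last [measurable]: "last \<in> PiM {1..T} (\<lambda>_. borel) \<rightarrow>\<^sub>M borel"
    unfolding last_def by (cases "T = 0") auto
  have upd [measurable]: "(\<lambda>(p, v). p(Suc T := v)) \<in> PiM {1..T} (\<lambda>_. borel) \<Otimes>\<^sub>M borel \<rightarrow>\<^sub>M PiM {1..Suc T} (\<lambda>_. borel)"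
    unfolding case_prod_beta by (rule measurable_fun_upd[where J = "{1..T}"]) auto
  have upd' [measurable]: "(\<lambda>x. (p x)(Suc T := v x)) \<in> N \<rightarrow>\<^sub>M PiM {1..Suc T} (\<lambda>_. borel)"
    if "p \<in> N \<rightarrow>\<^sub>M PiM {1..T} (\<lambda>_. borel)" "v \<in> N \<rightarrow>\<^sub>M borel" for p v and N :: "'z measure"
    using measurable_compose[OF measurable_Pair[OF that] upd] by simp
  have path: "(\<lambda>u. \<lambda>i\<in>{1..t}. noisy_iterate a w u i) \<in> PiM {1..t} (\<lambda>_. borel) \<rightarrow>\<^sub>M PiM {1..t} (\<lambda>_. borel)"
    if "\<And>i. i \<in> {1..t} \<Longrightarrow> a i \<in> borel \<rightarrow>\<^sub>M borel" for a t
  proof (rule measurable_restrict)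
    fix i assume i: "i \<in> {1..t}"
    show "(\<lambda>u. noisy_iterate a w u i) \<in> PiM {1..t} (\<lambda>_. borel) \<rightarrow>\<^sub>M borel"
    proof (rule measurable_noisy_iterate[where b = "\<lambda>_. a"])
      fix j assume "j \<in> {1..i}"
      then have j: "j \<in> {1..t}" using i by auto
      then have [measurable]: "a j \<in> borel \<rightarrow>\<^sub>M borel" by (rule that)
      show "(\<lambda>(x, w). a j w) \<in> PiM {1..t} (\<lambda>_. borel) \<Otimes>\<^sub>M borel \<rightarrow>\<^sub>M borel"
        by measurable
      show "(\<lambda>x. x j) \<in> PiM {1..t} (\<lambda>_. borel) \<rightarrow>\<^sub>M borel"
        using j by measurable
    qed simp
  qed
  have path': "(\<lambda>u. k (\<lambda>i\<in>{1..t}. noisy_iterate a w u i)) \<in> borel_measurable (PiM {1..t} \<rho>)"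
    if "\<And>i. i \<in> {1..t} \<Longrightarrow> a i \<in> borel \<rightarrow>\<^sub>M borel" "k \<in> borel_measurable (PiM {1..t} (\<lambda>_. borel))"
      "sets (PiM {1..t} \<rho>) = sets (PiM {1..t} (\<lambda>_. borel))" for a k t and \<rho> :: "nat \<Rightarrow> 'v measure"
    using measurable_compose[OF path[OF that(1)] that(2)] by (simp only: measurable_cong_sets[OF that(3) refl])
  \<comment> \<open>The last noise affects only the last iterate, so the longer path is the shorter
    one with a single new entry.\<close>
  have path_Suc: "(\<lambda>i\<in>{1..Suc T}. noisy_iterate a w (u(Suc T := y)) i)
      = (\<lambda>i\<in>{1..T}. noisy_iterate a w u i)(Suc T := a (Suc T) (last (\<lambda>i\<in>{1..T}. noisy_iterate a w u i)) + y)"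
    for a u y
  proof (intro ext)
    fix j
    have cong: "noisy_iterate a w (u(Suc T := y)) i = noisy_iterate a w u i" if "i \<le> T" for i
      by (rule noisy_iterate_cong) (use that in auto)
    show "(\<lambda>i\<in>{1..Suc T}. noisy_iterate a w (u(Suc T := y)) i) j
      = ((\<lambda>i\<in>{1..T}. noisy_iterate a w u i)(Suc T := a (Suc T) (last (\<lambda>i\<in>{1..T}. noisy_iterate a w u i)) + y)) j"
      by (auto simp: last_def cong)
  qed
  \<comment> \<open>The test function with its last step already taken by the second process; the
    induction hypothesis is applied to it.\<close>
  define f' where "f' p = (\<integral>\<^sup>+u. f (p(Suc T := c (Suc T) (last p) + u)) \<partial>\<mu> (Suc T))" for p
  have f' [measurable]: "f' \<in> borel_measurable (PiM {1..T} (\<lambda>_. borel))"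
    unfolding f'_def by measurable
  have "(\<integral>\<^sup>+\<xi>. f (\<lambda>i\<in>{1..Suc T}. noisy_iterate b w \<xi> i) \<partial>PiM {1..Suc T} \<nu>)
    = (\<integral>\<^sup>+\<xi>. (\<integral>\<^sup>+y. f (\<lambda>i\<in>{1..Suc T}. noisy_iterate b w (\<xi>(Suc T := y)) i) \<partial>\<nu> (Suc T)) \<partial>PiM {1..T} \<nu>)"
    unfolding I
  proof (rule P.product_nn_integral_insert)
    show "(\<lambda>\<xi>. f (\<lambda>i\<in>insert (Suc T) {1..T}. noisy_iterate b w \<xi> i)) \<in> borel_measurable (PiM (insert (Suc T) {1..T}) \<nu>)"
      unfolding I[symmetric] by (rule path'[OF Suc.prems(1,4) sets_PiM(1)])
  qed auto
  \<comment> \<open>For a fixed past only the new entry varies, and the one-step bound applies to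
    \<open>f\<close> as a function of that entry.\<close>
  also have "\<dots> \<le> (\<integral>\<^sup>+\<xi>. C (Suc T) * f' (\<lambda>i\<in>{1..T}. noisy_iterate b w \<xi> i) \<partial>PiM {1..T} \<nu>)"
  proof (intro nn_integral_mono)
    fix \<xi> :: "nat \<Rightarrow> 'v"
    let ?p = "\<lambda>i\<in>{1..T}. noisy_iterate b w \<xi> i"
    have p: "?p \<in> space (PiM {1..T} (\<lambda>_. borel))" by (simp add: space_PiM)
    have "(\<lambda>v. f (?p(Suc T := v))) \<in> borel_measurable borel"
      using measurable_const[OF p, of "borel :: 'v measure"] by measurable
    from Suc.prems(3)[OF _ this, of "Suc T" "last ?p"]
    show "(\<integral>\<^sup>+y. f (\<lambda>i\<in>{1..Suc T}. noisy_iterate b w (\<xi>(Suc T := y)) i) \<partial>\<nu> (Suc T)) \<le> C (Suc T) * f' ?p"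
      unfolding path_Suc f'_def by simp
  qed
  also have "\<dots> = C (Suc T) * (\<integral>\<^sup>+\<xi>. f' (\<lambda>i\<in>{1..T}. noisy_iterate b w \<xi> i) \<partial>PiM {1..T} \<nu>)"
    by (rule nn_integral_cmult) (rule path'[OF _ f' sets_PiM(1)], use Suc.prems(1) in auto)
  also have "\<dots> \<le> C (Suc T) * ((\<Prod>t=1..T. C t) * (\<integral>\<^sup>+u. f' (\<lambda>i\<in>{1..T}. noisy_iterate c w u i) \<partial>PiM {1..T} \<mu>))"
    by (rule mult_left_mono, rule Suc.IH[OF Suc.prems(1-3) f']) auto
  also have "(\<integral>\<^sup>+u. f' (\<lambda>i\<in>{1..T}. noisy_iterate c w u i) \<partial>PiM {1..T} \<mu>)
    = (\<integral>\<^sup>+u. (\<integral>\<^sup>+y. f (\<lambda>i\<in>{1..Suc T}. noisy_iterate c w (u(Suc T := y)) i) \<partial>\<mu> (Suc T)) \<partial>PiM {1..T} \<mu>)"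
    unfolding path_Suc f'_def ..
  also have "\<dots> = (\<integral>\<^sup>+u. f (\<lambda>i\<in>{1..Suc T}. noisy_iterate c w u i) \<partial>PiM {1..Suc T} \<mu>)"
    unfolding I
  proof (rule Q.product_nn_integral_insert[symmetric])
    show "(\<lambda>\<xi>. f (\<lambda>i\<in>insert (Suc T) {1..T}. noisy_iterate c w \<xi> i)) \<in> borel_measurable (PiM (insert (Suc T) {1..T}) \<mu>)"
      unfolding I[symmetric] by (rule path'[OF Suc.prems(2,4) sets_PiM(2)])
  qed auto
  finally show ?case unfolding prod_Suc mult.assoc .
qed

section \<open>Maximal leakage\<close>

text \<open>Setwise domination gives absolute continuity and, by considering the set where the
  density exceeds \<open>C\<close>, bounds the density by \<open>C\<close> almost
  everywhere.\<close>

lemma renyi_divergence_inf_le: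
  assumes "finite_measure P" "sigma_finite_measure N" and sets: "sets P = sets N" and "0 < C"
    and le: "\<And>A. A \<in> sets N \<Longrightarrow> emeasure P A \<le> ennreal C * emeasure N A"
  shows "renyi_divergence_inf P N \<le> ereal (ln C)"
proof -
  interpret P: finite_measure P by fact
  interpret N: sigma_finite_measure N by fact
  have ac: "absolutely_continuous N P"
    unfolding absolutely_continuous_def
  proof
    fix A assume A: "A \<in> null_sets N"
    then have "A \<in> sets N" "emeasure N A = 0" by auto
    then have "emeasure P A = 0" using le[of A] by simp
    then show "A \<in> null_sets P" using \<open>A \<in> sets N\<close> by (simp add: null_setsI sets)
  qed
  define f where "f = RN_deriv N P"
  have f [measurable]: "f \<in> borel_measurable N" by (simp add: f_def)
  have P_eq: "density N f = P" unfolding f_def by (rule N.density_RN_deriv[OF ac sets])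
  have P_int: "emeasure P A = (\<integral>\<^sup>+x. f x * indicator A x \<partial>N)" if "A \<in> sets N" for A
    using that by (subst P_eq[symmetric]) (simp add: emeasure_density)
  define A where "A = {x \<in> space N. ennreal C < f x}"
  have A [measurable]: "A \<in> sets N" unfolding A_def by measurable
  \<comment> \<open>On \<open>A\<close> the density is above \<open>C\<close>, while domination
    gives the opposite inequality for the integrals, so the two measures coincide there.\<close>
  have "density N (\<lambda>x. f x * indicator A x) = density N (\<lambda>x. ennreal C * indicator A x)"
  proof (rule measure_eqI)
    fix B assume "B \<in> sets (density N (\<lambda>x. f x * indicator A x))"
    then have [measurable]: "B \<in> sets N" by simp
    have "(\<integral>\<^sup>+x. f x * indicator A x * indicator B x \<partial>N) = emeasure P (A \<inter> B)"
      by (simp add: P_int indicator_inter_arith mult.assoc)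
    also have "\<dots> \<le> ennreal C * emeasure N (A \<inter> B)" by (intro le) simp
    also have "\<dots> = (\<integral>\<^sup>+x. ennreal C * indicator A x * indicator B x \<partial>N)"
      by (subst nn_integral_cmult_indicator[symmetric]) (simp_all add: indicator_inter_arith mult.assoc)
    finally have 1: "(\<integral>\<^sup>+x. f x * indicator A x * indicator B x \<partial>N) \<le> (\<integral>\<^sup>+x. ennreal C * indicator A x * indicator B x \<partial>N)" .
    have 2: "(\<integral>\<^sup>+x. ennreal C * indicator A x * indicator B x \<partial>N) \<le> (\<integral>\<^sup>+x. f x * indicator A x * indicator B x \<partial>N)"
      by (intro nn_integral_mono) (auto simp: indicator_def A_def)
    show "emeasure (density N (\<lambda>x. f x * indicator A x)) B = emeasure (density N (\<lambda>x. ennreal C * indicator A x)) B"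
      using 1 2 by (simp add: emeasure_density)
  qed simp
  \<comment> \<open>Finiteness lets equality of the two measures pass to equality of their densities
    almost everywhere. As \<open>f\<close> exceeds \<open>C\<close> on \<open>A\<close>, almost
    every point then lies outside \<open>A\<close>.\<close>
  moreover have "(\<integral>\<^sup>+x. f x * indicator A x \<partial>N) \<noteq> \<infinity>"
    using P.emeasure_finite[of A] by (simp add: P_int[symmetric])
  ultimately have "AE x in N. f x * indicator A x = ennreal C * indicator A x"
    by (subst (asm) finite_density_unique) auto
  then have "AE x in N. f x \<le> ennreal C"
  proof (rule AE_mp, intro AE_I2 impI)
    fix x assume "x \<in> space N" "f x * indicator A x = ennreal C * indicator A x"
    then show "f x \<le> ennreal C"
      by (cases "x \<in> A") (auto simp: A_def not_less)
  qed
  with sets ac have "AE x in P. f x \<le> ennreal C"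
    by (rule absolutely_continuous_AE)
  moreover have "f \<in> borel_measurable P"
    using f by (simp only: measurable_cong_sets[OF sets refl])
  ultimately have ess: "esssup P f \<le> ennreal C"
    by (intro esssup_I)
  have "ln_ennreal (esssup P f) \<le> ereal (ln C)"
  \<comment> \<open>At 0 the logarithm is \<open>-\<infinity>\<close> and the bound is immediate;
    otherwise the supremum is positive and finite, and monotonicity of the real logarithm
    applies.\<close>
  proof (cases "esssup P f = 0")
    case False
    have "esssup P f < \<infinity>" using ess by (simp add: order_le_less_trans)
    moreover from this False have "0 < enn2real (esssup P f)"
      by (simp add: enn2real_positive_iff zero_less_iff_neq_zero)
    moreover have "enn2real (esssup P f) \<le> C"
      using enn2real_mono[OF ess] \<open>0 < C\<close> by simp
    ultimately show ?thesis using False by (simp add: ln_ennreal_def)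
  qed (simp add: ln_ennreal_def)
  then show ?thesis using ac by (simp add: renyi_divergence_inf_def f_def)
qed

text \<open>Independence is the product formula on rectangles, and rectangles determine a product of
  sigma-finite measures.\<close>

lemma distr_pair_indep_rvs:
  assumes "prob_space M" "indep_rvs M MX X MY Y"
  shows "distr M (MX \<Otimes>\<^sub>M MY) (\<lambda>\<omega>. (X \<omega>, Y \<omega>)) = distr M MX X \<Otimes>\<^sub>M distr M MY Y"
proof -
  interpret prob_space M by fact
  have X [measurable]: "X \<in> M \<rightarrow>\<^sub>M MX" and Y [measurable]: "Y \<in> M \<rightarrow>\<^sub>M MY"
    and indep: "indep_set {X -` A \<inter> space M | A. A \<in> sets MX} {Y -` B \<inter> space M | B. B \<in> sets MY}"
    using assms(2) by (auto simp: indep_rvs_def)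
  show ?thesis
  proof (rule pair_measure_eqI[symmetric])
    fix A B assume "A \<in> sets (distr M MX X)" "B \<in> sets (distr M MY Y)"
    then have [measurable]: "A \<in> sets MX" "B \<in> sets MY" by auto
    have "prob ((X -` A \<inter> space M) \<inter> (Y -` B \<inter> space M)) = prob (X -` A \<inter> space M) * prob (Y -` B \<inter> space M)"
      by (rule indep_setD[OF indep]) auto
    moreover have "(\<lambda>\<omega>. (X \<omega>, Y \<omega>)) -` (A \<times> B) \<inter> space M = (X -` A \<inter> space M) \<inter> (Y -` B \<inter> space M)"
      by auto
    ultimately show "emeasure (distr M MX X) A * emeasure (distr M MY Y) B
        = emeasure (distr M (MX \<Otimes>\<^sub>M MY) (\<lambda>\<omega>. (X \<omega>, Y \<omega>))) (A \<times> B)"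
      by (simp add: emeasure_distr emeasure_eq_measure ennreal_mult[symmetric])
  qed (auto intro!: prob_space_imp_sigma_finite prob_space_distr cong: sets_pair_measure_cong)
qed

text \<open>Leakage is an infimum over output laws, so one \<open>Q\<close> whose product with the
  law of \<open>X\<close> dominates the joint law up to the factor \<open>C\<close>
  suffices.\<close>

lemma maximal_leakage_le:
  assumes "prob_space M" "X \<in> M \<rightarrow>\<^sub>M MX" "Y \<in> M \<rightarrow>\<^sub>M MY" and Q: "prob_space Q" "sets Q = sets MY" and "0 < C"
    and le: "\<And>A. A \<in> sets (MX \<Otimes>\<^sub>M MY) \<Longrightarrow>
      emeasure (distr M (MX \<Otimes>\<^sub>M MY) (\<lambda>\<omega>. (X \<omega>, Y \<omega>))) A \<le> ennreal C * emeasure (distr M MX X \<Otimes>\<^sub>M Q) A"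
  shows "maximal_leakage M MX MY X Y \<le> ereal (ln C)"
proof -
  interpret M: prob_space M by fact
  note [measurable] = assms(2,3)
  interpret PX: prob_space "distr M MX X" by (rule M.prob_space_distr) fact
  interpret Q: prob_space Q by fact
  interpret pair_prob_space "distr M MX X" Q ..
  interpret J: prob_space "distr M (MX \<Otimes>\<^sub>M MY) (\<lambda>\<omega>. (X \<omega>, Y \<omega>))" by (rule M.prob_space_distr) measurable
  have sets: "sets (distr M MX X \<Otimes>\<^sub>M Q) = sets (MX \<Otimes>\<^sub>M MY)"
    by (intro sets_pair_measure_cong) (simp_all add: Q)
  show ?thesis unfolding maximal_leakage_def
    by (rule INF_lower2[of Q])
      (use Q in \<open>auto intro!: renyi_divergence_inf_le J.finite_measure_axioms P.sigma_finite_measure_axioms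
         \<open>0 < C\<close> le simp: sets\<close>)
qed

text \<open>Empty \<open>I\<close>, which occurs for \<open>T = 0\<close>, is treated separately:
  both sides are then probability measures on a one-point space.\<close>

lemma distr_tuple_indep_vars:
  assumes "prob_space M" "prob_space.indep_vars M N X I"
  shows "distr M (PiM I N) (tuple I X) = PiM I (\<lambda>i. distr M (N i) (X i))"
proof -
  interpret prob_space M by fact
  have X: "X i \<in> M \<rightarrow>\<^sub>M N i" if "i \<in> I" for i
    using assms(2) that by (simp add: indep_vars_def)
  have tuple: "tuple I X = (\<lambda>\<omega>. \<lambda>i\<in>I. X i \<omega>)" by (simp add: tuple_def fun_eq_iff)
  show ?thesis
  proof (cases "I = {}")
    case True
    interpret Q: prob_space "PiM {} (\<lambda>i. distr M (N i) (X i))" by (rule prob_space_PiM) simp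
    have [measurable]: "(\<lambda>_. \<lambda>_. undefined) \<in> M \<rightarrow>\<^sub>M PiM {} N" by (rule measurable_const) simp
    interpret D: prob_space "distr M (PiM {} N) (\<lambda>_ _. undefined)" by (rule prob_space_distr) simp
    have "tuple {} X = (\<lambda>_ _. undefined)" by (simp add: tuple_def restrict_def fun_eq_iff)
    then show ?thesis unfolding True
    proof (simp only:, intro measure_eqI)
      fix A assume "A \<in> sets (distr M (PiM {} N) (\<lambda>_ _. undefined))"
      then have "A = {} \<or> A = {\<lambda>_. undefined}" by (simp add: sets_PiM_empty)
      then show "emeasure (distr M (PiM {} N) (\<lambda>_ _. undefined)) A = emeasure (PiM {} (\<lambda>i. distr M (N i) (X i))) A"
        using D.emeasure_space_1 Q.emeasure_space_1 by (auto simp: space_PiM_empty)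
    qed (simp add: sets_PiM_empty)
  next
    case False
    then show ?thesis
      using indep_vars_iff_distr_eq_PiM'[of I X N] X assms(2) by (simp add: tuple)
  qed
qed

theorem theorem9:
  fixes M :: "'a measure"
    and D :: "'z measure"
    and K :: "'o measure"
    and n T d :: nat
    and L :: real
    and \<eta> \<sigma> :: "nat \<Rightarrow> real"
    and g :: "real ^ 'd \<Rightarrow> real ^ 'd"
    and F :: "real ^ 'd \<Rightarrow> (nat \<Rightarrow>\<^sub>F 'z) \<Rightarrow> real ^ 'd"
    and Z' :: "nat \<Rightarrow> 'a \<Rightarrow> 'z"
    and S :: "'a \<Rightarrow> nat \<Rightarrow> 'z"
    and Z :: "nat \<Rightarrow> 'a \<Rightarrow> (nat \<Rightarrow>\<^sub>F 'z)"
    and W \<xi> :: "nat \<Rightarrow> 'a \<Rightarrow> real ^ 'd"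
    and h :: "(nat \<Rightarrow> real ^ 'd) \<Rightarrow> 'o"
  assumes d: "d = CARD('d)"
    and L_pos: "L > 0"
    and eta_pos: "\<And>t. t \<in> {1..T} \<Longrightarrow> \<eta> t > 0"
    and sigma_pos: "\<And>t. t \<in> {1..T} \<Longrightarrow> \<sigma> t > 0"
    and M: "prob_space M"
    and D: "prob_space D"
    and samples_indep: "prob_space.indep_vars M (\<lambda>_. D) Z' {1..n}"
    and samples_distr: "\<And>i. i \<in> {1..n} \<Longrightarrow> distr M D (Z' i) = D"
    and S: "S = tuple {1..n} Z'"
    and Z_measurable: "\<And>t. t \<in> {1..T} \<Longrightarrow> Z t \<in> M \<rightarrow>\<^sub>M batch_space n D"
    and Z_subset: "\<And>t \<omega>. t \<in> {1..T} \<Longrightarrow> \<omega> \<in> space M \<Longrightarrow> sub_batch (Z t \<omega>) n (S \<omega>)"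
    and g_measurable: "g \<in> borel \<rightarrow>\<^sub>M borel"
    and F_measurable: "(\<lambda>(w, z). F w z) \<in> borel \<Otimes>\<^sub>M batch_space n D \<rightarrow>\<^sub>M borel"
    and W0_indep:
      "indep_rvs M
         borel (W 0)
         (PiM {1..n} (\<lambda>_. D) \<Otimes>\<^sub>M PiM {1..T} (\<lambda>_. batch_space n D))
         (\<lambda>\<omega>. (S \<omega>, tuple {1..T} Z \<omega>))"
    and noise_mutually_indep: "prob_space.indep_vars M (\<lambda>_. borel) \<xi> {1..T}"
    and noise_indep:
      "indep_rvs M
         (PiM {1..T} (\<lambda>_. borel)) (tuple {1..T} \<xi>)
         (borel \<Otimes>\<^sub>M (PiM {1..n} (\<lambda>_. D) \<Otimes>\<^sub>M PiM {1..T} (\<lambda>_. batch_space n D)))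
         (\<lambda>\<omega>. (W 0 \<omega>, (S \<omega>, tuple {1..T} Z \<omega>)))"
    and update:
      "\<And>t \<omega>. t \<in> {1..T} \<Longrightarrow> \<omega> \<in> space M \<Longrightarrow>
         W t \<omega> = g (W (t - 1) \<omega>) - \<eta> t *\<^sub>R F (W (t - 1) \<omega>) (Z t \<omega>) + \<xi> t \<omega>"
    and sampling_strategy:
      "\<And>t A. t < T \<Longrightarrow> A \<in> sets (batch_space n D) \<Longrightarrow>
         AE \<omega> in M.
           cond_prob_given M
             (PiM {1..t} (\<lambda>_. batch_space n D) \<Otimes>\<^sub>M
                (PiM {1..t} (\<lambda>_. borel) \<Otimes>\<^sub>M PiM {1..n} (\<lambda>_. D)))
             (\<lambda>\<omega>. (tuple {1..t} Z \<omega>, (tuple {1..t} W \<omega>, S \<omega>)))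
             (Z (t + 1) -` A \<inter> space M) \<omega>
         = cond_prob_given M
             (PiM {1..t} (\<lambda>_. batch_space n D) \<Otimes>\<^sub>M PiM {1..n} (\<lambda>_. D))
             (\<lambda>\<omega>. (tuple {1..t} Z \<omega>, S \<omega>))
             (Z (t + 1) -` A \<inter> space M) \<omega>"
    and F_bounded: "\<And>w z. z \<in> space (batch_space n D) \<Longrightarrow> l1_norm (F w z) \<le> L"
    and noise_normal:
      "\<And>t. t \<in> {1..T} \<Longrightarrow> distributed M lborel (\<xi> t) (\<lambda>x. ennreal (isotropic_normal_density (\<sigma> t) x))"
    and h_measurable: "h \<in> PiM {1..T} (\<lambda>_. borel) \<rightarrow>\<^sub>M K"
  shows "maximal_leakage M (PiM {1..n} (\<lambda>_. D)) K S (\<lambda>\<omega>. h (tuple {1..T} W \<omega>))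
    \<le> ereal (\<Sum>t = 1..T. ln (
         V1 d (\<eta> t * L) / (2 * pi * (\<sigma> t)\<^sup>2) powr (real d / 2)
         + (2 * \<eta> t * L) ^ (d - 1) * (\<sigma> t * sqrt (2 * real d))
             / ((2 * pi * (\<sigma> t)\<^sup>2) powr (real d / 2) * fact (d - 1))
           * (\<Sum>i = 0..d - 1. real (d - 1 choose i) * (\<sigma> t * sqrt (2 * real d) / (\<eta> t * L)) ^ i
                * Gamma ((real i + 1) / 2))))"
proof -

  \<comment> \<open>Spaces, drifts and step laws\<close>
  interpret M: prob_space M by (rule M)
  define N\<^sub>S where "N\<^sub>S = PiM {1..n} (\<lambda>_. D)"
  define N\<^sub>Z where "N\<^sub>Z = PiM {1..T} (\<lambda>_. batch_space n D)"
  define N\<^sub>W where "N\<^sub>W = PiM {1..T} (\<lambda>_. borel :: (real ^ 'd) measure)"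
  define b where "b z t w = g w - \<eta> t *\<^sub>R F w (z t)" for z t w
  define path where "path a w u = (\<lambda>i\<in>{1..T}. noisy_iterate a w u i)"
    for a :: "nat \<Rightarrow> real ^ 'd \<Rightarrow> real ^ 'd" and w u
  \<comment> \<open>Outside the time range both families are filled with a Dirac mass at 0, so that
    every member is a probability measure on the Borel sets.\<close>
  define \<nu> where "\<nu> t = (if t \<in> {1..T} then distr M borel (\<xi> t) else return borel 0)" for t
  define \<mu> :: "nat \<Rightarrow> (real ^ 'd) measure"
    where "\<mu> t = (if t \<in> {1..T} then envelope_distr (\<eta> t * L) (\<sigma> t) else return borel 0)" for t
  define C where "C = (\<Prod>t=1..T. envelope_mass d (\<eta> t * L) (\<sigma> t))"
  have pos: "0 < envelope_mass d (\<eta> t * L) (\<sigma> t)" if "t \<in> {1..T}" for t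
    using that eta_pos sigma_pos L_pos by (intro envelope_mass_pos) (auto simp: d)
  have C_pos: "0 < C" unfolding C_def by (intro prod_pos pos)
  have C_eq: "(\<Prod>t=1..T. ennreal (envelope_mass d (\<eta> t * L) (\<sigma> t))) = ennreal C"
    unfolding C_def by (intro prod_ennreal less_imp_le pos)

  \<comment> \<open>Measurability of the inputs and of the paths\<close>
  have W0 [measurable]: "W 0 \<in> M \<rightarrow>\<^sub>M borel"
    and SZ [measurable]: "(\<lambda>\<omega>. (S \<omega>, tuple {1..T} Z \<omega>)) \<in> M \<rightarrow>\<^sub>M N\<^sub>S \<Otimes>\<^sub>M N\<^sub>Z"
    using W0_indep by (auto simp: indep_rvs_def N\<^sub>S_def N\<^sub>Z_def)
  have S_meas [measurable]: "S \<in> M \<rightarrow>\<^sub>M N\<^sub>S" and Z_meas [measurable]: "tuple {1..T} Z \<in> M \<rightarrow>\<^sub>M N\<^sub>Z"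
    using measurable_compose[OF SZ measurable_fst] measurable_compose[OF SZ measurable_snd] by simp_all
  have \<xi>_meas [measurable]: "tuple {1..T} \<xi> \<in> M \<rightarrow>\<^sub>M N\<^sub>W"
    using noise_indep by (auto simp: indep_rvs_def N\<^sub>W_def)
  have \<xi>_t: "\<xi> t \<in> M \<rightarrow>\<^sub>M borel" if "t \<in> {1..T}" for t
    using distributed_measurable[OF noise_normal[OF that]] by simp
  note [measurable] = g_measurable
  have h [measurable]: "h \<in> N\<^sub>W \<rightarrow>\<^sub>M K" using h_measurable by (simp add: N\<^sub>W_def)

  have \<nu>: "prob_space (\<nu> t)" "sets (\<nu> t) = sets borel" for t
    using \<xi>_t by (auto simp: \<nu>_def intro!: M.prob_space_distr prob_space_return)
  have \<mu>: "prob_space (\<mu> t)" "sets (\<mu> t) = sets borel" for t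
    using eta_pos sigma_pos L_pos
    by (auto simp: \<mu>_def intro!: prob_space_envelope_distr prob_space_return)
  have sets_\<nu> [measurable_cong]: "sets (PiM {1..T} \<nu>) = sets N\<^sub>W" and sets_\<mu> [measurable_cong]: "sets (PiM {1..T} \<mu>) = sets N\<^sub>W"
    unfolding N\<^sub>W_def by (auto intro!: sets_PiM_cong simp: \<nu> \<mu>)

  have path_meas: "(\<lambda>x. path (a x) (w x) (u x)) \<in> N \<rightarrow>\<^sub>M N\<^sub>W"
    if a: "\<And>i. i \<in> {1..T} \<Longrightarrow> (\<lambda>(x, w). a x i w) \<in> N \<Otimes>\<^sub>M borel \<rightarrow>\<^sub>M borel"
      and w: "w \<in> N \<rightarrow>\<^sub>M borel" and u: "u \<in> N \<rightarrow>\<^sub>M N\<^sub>W" for a w u and N :: "'y measure"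
    unfolding path_def N\<^sub>W_def
  proof (intro measurable_restrict measurable_noisy_iterate w)
    fix t i assume "t \<in> {1..T}" "i \<in> {1..t}"
    then have i: "i \<in> {1..T}" by auto
    then show "(\<lambda>(x, w). a x i w) \<in> N \<Otimes>\<^sub>M borel \<rightarrow>\<^sub>M borel" by (rule a)
    show "(\<lambda>x. u x i) \<in> N \<rightarrow>\<^sub>M borel"
      using measurable_compose[OF u[unfolded N\<^sub>W_def] measurable_component_singleton[OF i]] .
  qed
  have path_g [measurable]: "(\<lambda>x. path (\<lambda>_. g) (w x) (u x)) \<in> N \<rightarrow>\<^sub>M N\<^sub>W"
    if "w \<in> N \<rightarrow>\<^sub>M borel" "u \<in> N \<rightarrow>\<^sub>M N\<^sub>W" for w u and N :: "'y measure"
    by (rule path_meas[OF _ that]) measurable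
  have b_meas: "(\<lambda>(x, w). b (z x) t w) \<in> N \<Otimes>\<^sub>M borel \<rightarrow>\<^sub>M borel"
    if t: "t \<in> {1..T}" and z: "z \<in> N \<rightarrow>\<^sub>M N\<^sub>Z" for t z and N :: "'y measure"
  proof -
    have [measurable]: "(\<lambda>x. z x t) \<in> N \<rightarrow>\<^sub>M batch_space n D"
      using measurable_compose[OF z[unfolded N\<^sub>Z_def] measurable_component_singleton[OF t]] .
    have [measurable]: "(\<lambda>p. F (snd p) (z (fst p) t)) \<in> N \<Otimes>\<^sub>M borel \<rightarrow>\<^sub>M borel"
      using measurable_compose[OF _ F_measurable, of "\<lambda>p. (snd p, z (fst p) t)" "N \<Otimes>\<^sub>M borel"] by simp
    show ?thesis unfolding b_def case_prod_beta by measurable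
  qed
  have path_b [measurable]: "(\<lambda>x. path (b (z x)) (w x) (u x)) \<in> N \<rightarrow>\<^sub>M N\<^sub>W"
    if "z \<in> N \<rightarrow>\<^sub>M N\<^sub>Z" "w \<in> N \<rightarrow>\<^sub>M borel" "u \<in> N \<rightarrow>\<^sub>M N\<^sub>W" for z w u and N :: "'y measure"
    by (rule path_meas[OF b_meas[OF _ that(1)] that(2,3)])

  \<comment> \<open>The algorithm as an iteration driven by start, mini-batches and noise\<close>
  have W_path: "tuple {1..T} W \<omega> = path (b (tuple {1..T} Z \<omega>)) (W 0 \<omega>) (tuple {1..T} \<xi> \<omega>)"
    if \<omega>: "\<omega> \<in> space M" for \<omega>
  proof -
    have "noisy_iterate (b (tuple {1..T} Z \<omega>)) (W 0 \<omega>) (tuple {1..T} \<xi> \<omega>) t = W t \<omega>" if "t \<le> T" for t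
      using that
    proof (induction t)
      case (Suc t)
      then show ?case using update[of "Suc t" \<omega>] \<omega> by (simp add: b_def tuple_def)
    qed simp
    then show ?thesis by (auto simp: tuple_def path_def)
  qed

  \<comment> \<open>Domination of a single step\<close>
  have step: "(\<integral>\<^sup>+y. k (b z t w + y) \<partial>\<nu> t)
      \<le> ennreal (envelope_mass d (\<eta> t * L) (\<sigma> t)) * (\<integral>\<^sup>+u. k (g w + u) \<partial>\<mu> t)"
    if t: "t \<in> {1..T}" and k [measurable]: "k \<in> borel_measurable borel" and z: "z \<in> space N\<^sub>Z" for t k z w
  proof -
    have zt: "z t \<in> space (batch_space n D)" using z t by (auto simp: N\<^sub>Z_def space_PiM)
    \<comment> \<open>This is the radius of the envelope: the direction bound holds for every point
      of the batch space, hence for each frozen mini-batch.\<close>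
    have le: "l1_norm (\<eta> t *\<^sub>R F w (z t)) \<le> \<eta> t * L"
      using F_bounded[OF zt, of w] eta_pos[OF t]
      by (simp add: l1_norm_def abs_mult sum_distrib_left[symmetric])
    have [measurable]: "isotropic_normal_density (\<sigma> t) \<in> borel_measurable (borel :: (real ^ 'd) measure)"
      unfolding isotropic_normal_density_def by measurable
    have "\<nu> t = density lborel (\<lambda>x. ennreal (isotropic_normal_density (\<sigma> t) x))"
      using t distributed_distr_eq_density[OF noise_normal[OF t]]
      by (simp add: \<nu>_def cong: distr_cong)
    then have "(\<integral>\<^sup>+y. k (b z t w + y) \<partial>\<nu> t)
        = (\<integral>\<^sup>+y. ennreal (isotropic_normal_density (\<sigma> t) y) * k (g w - \<eta> t *\<^sub>R F w (z t) + y) \<partial>lborel)"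
      by (simp add: nn_integral_density b_def)
    also have "\<dots> \<le> ennreal (envelope_mass CARD('d) (\<eta> t * L) (\<sigma> t))
        * (\<integral>\<^sup>+u. k (g w + u) \<partial>envelope_distr (\<eta> t * L) (\<sigma> t))"
      by (rule nn_integral_shifted_normal_le) (use le t eta_pos sigma_pos L_pos in auto)
    finally show ?thesis using t by (simp add: d \<mu>_def)
  qed

  \<comment> \<open>The data-free output law and the joint law of the inputs\<close>
  define P\<^sub>W P\<^sub>S P\<^sub>S\<^sub>Z where "P\<^sub>W = distr M borel (W 0)" and "P\<^sub>S = distr M N\<^sub>S S"
    and "P\<^sub>S\<^sub>Z = distr M (N\<^sub>S \<Otimes>\<^sub>M N\<^sub>Z) (\<lambda>\<omega>. (S \<omega>, tuple {1..T} Z \<omega>))"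
  \<comment> \<open>The witness for the infimum: it keeps the true law of the start, which is
    independent of the data, and replaces every noisy step by a draw from the normalised
    envelope.\<close>
  define Q where "Q = distr (P\<^sub>W \<Otimes>\<^sub>M PiM {1..T} \<mu>) K (\<lambda>(w, u). h (path (\<lambda>_. g) w u))"
  have sets_P [simp, measurable_cong]: "sets P\<^sub>W = sets borel" "sets P\<^sub>S = sets N\<^sub>S" "sets P\<^sub>S\<^sub>Z = sets (N\<^sub>S \<Otimes>\<^sub>M N\<^sub>Z)"
    by (simp_all add: P\<^sub>W_def P\<^sub>S_def P\<^sub>S\<^sub>Z_def)
  interpret P\<^sub>W: prob_space P\<^sub>W unfolding P\<^sub>W_def by (rule M.prob_space_distr) measurable
  interpret P\<^sub>S: prob_space P\<^sub>S unfolding P\<^sub>S_def by (rule M.prob_space_distr) measurable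
  interpret P\<^sub>S\<^sub>Z: prob_space P\<^sub>S\<^sub>Z unfolding P\<^sub>S\<^sub>Z_def by (rule M.prob_space_distr) measurable
  interpret \<mu>: prob_space "PiM {1..T} \<mu>" by (intro prob_space_PiM \<mu>)
  interpret \<nu>: prob_space "PiM {1..T} \<nu>" by (intro prob_space_PiM \<nu>)
  interpret W\<mu>: pair_prob_space P\<^sub>W "PiM {1..T} \<mu>" ..
  interpret WS: pair_prob_space P\<^sub>W P\<^sub>S ..
  have final_meas [measurable]: "(\<lambda>(w, u). h (path (\<lambda>_. g) w u)) \<in> P\<^sub>W \<Otimes>\<^sub>M PiM {1..T} \<mu> \<rightarrow>\<^sub>M K"
    by measurable
  interpret Q: prob_space Q unfolding Q_def by (rule W\<mu>.prob_space_distr) (rule final_meas)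
  have sets_Q [simp, measurable_cong]: "sets Q = sets K" by (simp add: Q_def)

  have distr_\<xi>: "distr M N\<^sub>W (tuple {1..T} \<xi>) = PiM {1..T} \<nu>"
    unfolding N\<^sub>W_def distr_tuple_indep_vars[OF M noise_mutually_indep]
    by (rule PiM_cong) (auto simp: \<nu>_def)
  have distr_A: "distr M (borel \<Otimes>\<^sub>M (N\<^sub>S \<Otimes>\<^sub>M N\<^sub>Z)) (\<lambda>\<omega>. (W 0 \<omega>, (S \<omega>, tuple {1..T} Z \<omega>))) = P\<^sub>W \<Otimes>\<^sub>M P\<^sub>S\<^sub>Z"
    unfolding P\<^sub>W_def P\<^sub>S\<^sub>Z_def N\<^sub>S_def N\<^sub>Z_def by (rule distr_pair_indep_rvs[OF M W0_indep])
  \<comment> \<open>Noises, start and the pair of data and mini-batches form a product; the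
    dependence of the mini-batches on the data stays inside
    \<open>P\<^sub>S\<^sub>Z\<close>.\<close>
  have distr_all: "distr M (N\<^sub>W \<Otimes>\<^sub>M (borel \<Otimes>\<^sub>M (N\<^sub>S \<Otimes>\<^sub>M N\<^sub>Z)))
      (\<lambda>\<omega>. (tuple {1..T} \<xi> \<omega>, (W 0 \<omega>, (S \<omega>, tuple {1..T} Z \<omega>)))) = PiM {1..T} \<nu> \<Otimes>\<^sub>M (P\<^sub>W \<Otimes>\<^sub>M P\<^sub>S\<^sub>Z)"
    unfolding distr_\<xi>[symmetric] distr_A[symmetric]
    unfolding N\<^sub>W_def N\<^sub>S_def N\<^sub>Z_def by (rule distr_pair_indep_rvs[OF M noise_indep])

  have W_meas: "tuple {1..T} W \<in> M \<rightarrow>\<^sub>M N\<^sub>W"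
  proof (subst measurable_cong[OF W_path])
    show "(\<lambda>\<omega>. path (b (tuple {1..T} Z \<omega>)) (W 0 \<omega>) (tuple {1..T} \<xi> \<omega>)) \<in> M \<rightarrow>\<^sub>M N\<^sub>W"
      by measurable
  qed
  have out_meas [measurable]: "(\<lambda>\<omega>. h (tuple {1..T} W \<omega>)) \<in> M \<rightarrow>\<^sub>M K"
    by (rule measurable_compose[OF W_meas h])

  \<comment> \<open>Domination of the joint law of data and output\<close>
  have main: "(\<integral>\<^sup>+\<omega>. f (S \<omega>, h (tuple {1..T} W \<omega>)) \<partial>M) \<le> ennreal C * (\<integral>\<^sup>+x. f x \<partial>(P\<^sub>S \<Otimes>\<^sub>M Q))"
    if f [measurable]: "f \<in> borel_measurable (N\<^sub>S \<Otimes>\<^sub>M K)" for f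
  proof -
    \<comment> \<open>The data-free counterpart of the integral over the noise. It depends on the
      data only through the first argument of \<open>f\<close>.\<close>
    define \<phi> where "\<phi> w s = (\<integral>\<^sup>+u. f (s, h (path (\<lambda>_. g) w u)) \<partial>PiM {1..T} \<mu>)" for w s
    have \<phi> [measurable]: "(\<lambda>(w, s). \<phi> w s) \<in> borel_measurable (borel \<Otimes>\<^sub>M N\<^sub>S)"
      unfolding \<phi>_def by measurable
    define G where "G = (\<lambda>(\<xi>, (w, (s, z))). f (s, h (path (b z) w \<xi>)))"
    have G [measurable]: "G \<in> borel_measurable (N\<^sub>W \<Otimes>\<^sub>M (borel \<Otimes>\<^sub>M (N\<^sub>S \<Otimes>\<^sub>M N\<^sub>Z)))"
      unfolding G_def case_prod_beta by measurable
    interpret A: pair_prob_space P\<^sub>W P\<^sub>S\<^sub>Z ..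
    interpret \<nu>A: pair_prob_space "PiM {1..T} \<nu>" "P\<^sub>W \<Otimes>\<^sub>M P\<^sub>S\<^sub>Z" ..
    have "(\<integral>\<^sup>+\<omega>. f (S \<omega>, h (tuple {1..T} W \<omega>)) \<partial>M)
      = (\<integral>\<^sup>+\<omega>. G (tuple {1..T} \<xi> \<omega>, (W 0 \<omega>, (S \<omega>, tuple {1..T} Z \<omega>))) \<partial>M)"
      by (intro nn_integral_cong) (simp only: G_def W_path prod.case)
    also have "\<dots> = (\<integral>\<^sup>+x. G x \<partial>(PiM {1..T} \<nu> \<Otimes>\<^sub>M (P\<^sub>W \<Otimes>\<^sub>M P\<^sub>S\<^sub>Z)))"
      unfolding distr_all[symmetric]
      by (rule nn_integral_distr[symmetric])
        (intro measurable_Pair \<xi>_meas W0 S_meas Z_meas, simp add: G)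
    \<comment> \<open>The noise is integrated first, so that start, data and mini-batches are
      constants in the path comparison.\<close>
    also have "\<dots> = (\<integral>\<^sup>+a. (\<integral>\<^sup>+\<xi>. G (\<xi>, a) \<partial>PiM {1..T} \<nu>) \<partial>(P\<^sub>W \<Otimes>\<^sub>M P\<^sub>S\<^sub>Z))"
      by (rule \<nu>A.nn_integral_snd[symmetric]) measurable
    also have "\<dots> \<le> (\<integral>\<^sup>+a. ennreal C * \<phi> (fst a) (fst (snd a)) \<partial>(P\<^sub>W \<Otimes>\<^sub>M P\<^sub>S\<^sub>Z))"
    proof (intro nn_integral_mono)
      fix a assume "a \<in> space (P\<^sub>W \<Otimes>\<^sub>M P\<^sub>S\<^sub>Z)"
      then obtain w s z where a: "a = (w, (s, z))" and s: "s \<in> space N\<^sub>S" and z: "z \<in> space N\<^sub>Z"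
        by (auto simp: space_pair_measure sets_eq_imp_space_eq[OF sets_P(3)])
      have "(\<integral>\<^sup>+\<xi>. f (s, h (\<lambda>i\<in>{1..T}. noisy_iterate (b z) w \<xi> i)) \<partial>PiM {1..T} \<nu>)
        \<le> (\<Prod>t=1..T. ennreal (envelope_mass d (\<eta> t * L) (\<sigma> t)))
          * (\<integral>\<^sup>+u. f (s, h (\<lambda>i\<in>{1..T}. noisy_iterate (\<lambda>_. g) w u i)) \<partial>PiM {1..T} \<mu>)"
      proof (rule nn_integral_noisy_iterate_le[OF \<nu> \<mu>, where f = "\<lambda>p. f (s, h p)"])
        show "b z t \<in> borel \<rightarrow>\<^sub>M borel" if "t \<in> {1..T}" for t
          using measurable_compose[OF measurable_Pair1' b_meas[OF that measurable_ident], OF z] by simp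
        show "(\<lambda>p. f (s, h p)) \<in> borel_measurable (PiM {1..T} (\<lambda>_. borel))"
          unfolding N\<^sub>W_def[symmetric] using s by measurable
      qed (use step z in auto)
      then show "(\<integral>\<^sup>+\<xi>. G (\<xi>, a) \<partial>PiM {1..T} \<nu>) \<le> ennreal C * \<phi> (fst a) (fst (snd a))"
        by (simp only: a G_def \<phi>_def C_eq path_def prod.case fst_conv snd_conv)
    qed
    also have "\<dots> = ennreal C * (\<integral>\<^sup>+a. \<phi> (fst a) (fst (snd a)) \<partial>(P\<^sub>W \<Otimes>\<^sub>M P\<^sub>S\<^sub>Z))"
      by (rule nn_integral_cmult) measurable
    also have "(\<integral>\<^sup>+a. \<phi> (fst a) (fst (snd a)) \<partial>(P\<^sub>W \<Otimes>\<^sub>M P\<^sub>S\<^sub>Z)) = (\<integral>\<^sup>+w. (\<integral>\<^sup>+x. \<phi> w (fst x) \<partial>P\<^sub>S\<^sub>Z) \<partial>P\<^sub>W)"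
      by (subst P\<^sub>S\<^sub>Z.nn_integral_fst[symmetric]) auto
    \<comment> \<open>The mini-batches have disappeared from the integrand, so only the marginal law
      of the data remains.\<close>
    also have "\<dots> = (\<integral>\<^sup>+w. (\<integral>\<^sup>+s. \<phi> w s \<partial>P\<^sub>S) \<partial>P\<^sub>W)"
    proof (intro nn_integral_cong)
      fix w assume "w \<in> space P\<^sub>W"
      have \<phi>_w [measurable]: "\<phi> w \<in> borel_measurable N\<^sub>S"
        using measurable_compose[OF measurable_Pair1' \<phi>, of w] by simp
      have "(\<integral>\<^sup>+x. \<phi> w (fst x) \<partial>P\<^sub>S\<^sub>Z) = (\<integral>\<^sup>+\<omega>. \<phi> w (S \<omega>) \<partial>M)"
        unfolding P\<^sub>S\<^sub>Z_def by (subst nn_integral_distr[OF SZ]) simp_all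
      also have "\<dots> = (\<integral>\<^sup>+s. \<phi> w s \<partial>P\<^sub>S)"
        unfolding P\<^sub>S_def by (rule nn_integral_distr[OF S_meas, symmetric]) simp
      finally show "(\<integral>\<^sup>+x. \<phi> w (fst x) \<partial>P\<^sub>S\<^sub>Z) = (\<integral>\<^sup>+s. \<phi> w s \<partial>P\<^sub>S)" .
    qed
    \<comment> \<open>With the data outermost, the integrals over start and envelope noise combine
      to an integral against \<open>Q\<close>.\<close>
    also have "\<dots> = (\<integral>\<^sup>+s. (\<integral>\<^sup>+w. \<phi> w s \<partial>P\<^sub>W) \<partial>P\<^sub>S)"
      by (rule WS.Fubini'[symmetric]) measurable
    also have "\<dots> = (\<integral>\<^sup>+s. (\<integral>\<^sup>+q. f (s, q) \<partial>Q) \<partial>P\<^sub>S)"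
    proof (intro nn_integral_cong)
      fix s assume "s \<in> space P\<^sub>S"
      then have [measurable]: "s \<in> space N\<^sub>S" by (simp add: P\<^sub>S_def)
      have "(\<integral>\<^sup>+q. f (s, q) \<partial>Q) = (\<integral>\<^sup>+x. f (s, h (path (\<lambda>_. g) (fst x) (snd x))) \<partial>(P\<^sub>W \<Otimes>\<^sub>M PiM {1..T} \<mu>))"
        unfolding Q_def using \<open>s \<in> space N\<^sub>S\<close>
        by (subst nn_integral_distr[OF final_meas]) (simp_all add: case_prod_beta)
      also have "\<dots> = (\<integral>\<^sup>+w. \<phi> w s \<partial>P\<^sub>W)"
        unfolding \<phi>_def
      proof (subst \<mu>.nn_integral_fst[symmetric])
        show "(\<lambda>x. f (s, h (path (\<lambda>_. g) (fst x) (snd x)))) \<in> borel_measurable (P\<^sub>W \<Otimes>\<^sub>M PiM {1..T} \<mu>)"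
          by measurable
      qed simp
      finally show "(\<integral>\<^sup>+w. \<phi> w s \<partial>P\<^sub>W) = (\<integral>\<^sup>+q. f (s, q) \<partial>Q)" by simp
    qed
    also have "\<dots> = (\<integral>\<^sup>+x. f x \<partial>(P\<^sub>S \<Otimes>\<^sub>M Q))"
      by (rule Q.nn_integral_fst) measurable
    finally show ?thesis .
  qed

  \<comment> \<open>From domination to the leakage bound\<close>
  have "maximal_leakage M N\<^sub>S K S (\<lambda>\<omega>. h (tuple {1..T} W \<omega>)) \<le> ereal (ln C)"
  proof (rule maximal_leakage_le[OF M S_meas out_meas Q.prob_space_axioms sets_Q C_pos])
    fix A assume A [measurable]: "A \<in> sets (N\<^sub>S \<Otimes>\<^sub>M K)"
    have A': "A \<in> sets (P\<^sub>S \<Otimes>\<^sub>M Q)"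
      using A by (simp cong: sets_pair_measure_cong)
    have "emeasure (distr M (N\<^sub>S \<Otimes>\<^sub>M K) (\<lambda>\<omega>. (S \<omega>, h (tuple {1..T} W \<omega>)))) A
        = (\<integral>\<^sup>+x. indicator A x \<partial>distr M (N\<^sub>S \<Otimes>\<^sub>M K) (\<lambda>\<omega>. (S \<omega>, h (tuple {1..T} W \<omega>))))"
      by (rule nn_integral_indicator[symmetric]) simp
    also have "\<dots> = (\<integral>\<^sup>+\<omega>. indicator A (S \<omega>, h (tuple {1..T} W \<omega>)) \<partial>M)"
      by (rule nn_integral_distr) measurable
    also have "\<dots> \<le> ennreal C * (\<integral>\<^sup>+x. indicator A x \<partial>(P\<^sub>S \<Otimes>\<^sub>M Q))"
      by (rule main) measurable
    also have "(\<integral>\<^sup>+x. indicator A x \<partial>(P\<^sub>S \<Otimes>\<^sub>M Q)) = emeasure (distr M N\<^sub>S S \<Otimes>\<^sub>M Q) A"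
      using A' by (simp add: P\<^sub>S_def)
    finally show "emeasure (distr M (N\<^sub>S \<Otimes>\<^sub>M K) (\<lambda>\<omega>. (S \<omega>, h (tuple {1..T} W \<omega>)))) A
        \<le> ennreal C * emeasure (distr M N\<^sub>S S \<Otimes>\<^sub>M Q) A" .
  qed
  also have "ln C = (\<Sum>t=1..T. ln (envelope_mass d (\<eta> t * L) (\<sigma> t)))"
    unfolding C_def by (rule ln_prod) (simp, metis pos less_irrefl)
  finally show ?thesis
    by (simp only: N\<^sub>S_def envelope_mass_def mult.assoc)
qed

end
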